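(* Let $n\ge 1$, let $\mathbb{I}=\{S_i\}_{i=1}^N$ be an affine IFS on $\mathbb{R}^n$ with affinity dimension $s$, let $C\subset\mathbb{R}^n$ be a non-empty compact set, let $F_\emptyset$ be the homogeneous attractor of $\mathbb{I}$ and let $F_C$ be the inhomogeneous self-affine set of $\mathbb{I}$ with condensation set $C$. Then $$\max\{\overline{\dim}_{\mathrm{B}} F_\emptyset,\ \overline{\dim}_{\mathrm{B}} C\}\ \le\ \overline{\dim}_{\mathrm{B}} F_C\ \le\ \max\{s,\ \overline{\dim}_{\mathrm{B}} C\}.$$
   Context: An affine IFS on $\mathbb{R}^n$ is a finite collection $\{S_i\}_{i=1}^N$ of affine maps $S_i(x)=A_ix+b_i$ with $A_i\in \mathrm{GL}(\mathbb{R},n)$, $b_i\in\mathbb{R}^n$, each contracting: there is $c\in(0,1)$ with $|S_i(x)-S_i(y)|\le c|x-y|$ for all $x,y$ (Euclidean norm). The homogeneous attractor $F_\emptyset$ is the unique non-empty compact set with $F_\emptyset=\bigcup_{i=1}^N S_i(F_\emptyset)$. For compact $C\subset\mathbb{R}^n$, the inhomogeneous self-affine set $F_C$ with condensation set $C$ is the unique non-empty compact set with $F_C=\bigcup_{i=1}^N S_i(F_C)\cup C$. Words: $\mathcal{I}=\{1,\dots,N\}$, and for $\mathbf{i}=(i_1,\dots,i_k)\in\mathcal{I}^k$, $S_{\mathbf{i}}=S_{i_1}\circ\cdots\circ S_{i_k}$. Affinity dimension: for $A\in\mathrm{GL}(\mathbb{R},n)$ let $\alpha_1(A)\ge\dots\ge\alpha_n(A)>0$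 be its singular values. For $0< t\le n$ put $\phi^t(A)=\alpha_1(A)\cdots\alpha_{m-1}(A)\,\alpha_m(A)^{t-m+1}$, where $m$ is the integer with $m-1<t\le m$; put $\phi^0(A)=1$ and $\phi^t(A)=|\det A|^{t/n}$ for $t>n$. For an affine map $S$ with linear part $A$, $\phi^t(S)=\phi^t(A)$. For $k\in\mathbb{N}$ let $s_k$ be the solution of $\sum_{\mathbf{i}\in\mathcal{I}^k}\phi^{s_k}(S_{\mathbf{i}})=1$. The limit $s=\lim_{k\to\infty}s_k$ exists and is called the affinity dimension of the IFS. Box dimension: for non-empty bounded $F\subset\mathbb{R}^n$, $N_\delta(F)$ is the minimum number of hypercubes of sidelength $\delta$ needed to cover $F$, and $\overline{\dim}_{\mathrm{B}}F=\limsup_{\delta\to0}\frac{\log N_\delta(F)}{-\log\delta}$. *)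

theory Defs
  imports "HOL-Analysis.Analysis" "HOL-Library.Multiset"
begin

subsection \<open>Affine iterated function systems\<close>

definition affine_ifs :: "nat \<Rightarrow> (nat \<Rightarrow> real^'n \<Rightarrow> real^'n) \<Rightarrow> bool" where
  "affine_ifs N S \<longleftrightarrow> N \<ge> 1 \<and>
     (\<forall>i\<in>{1..N}.
        (\<exists>A b. invertible A \<and> (\<forall>x. S i x = A *v x + b)) \<and>
        (\<exists>c. 0 < c \<and> c < 1 \<and> (\<forall>x y. norm (S i x - S i y) \<le> c * norm (x - y))))"

text \<open>
  For an affine IFS there is exactly one set with the property below (for every compact \<open>C\<close>,
  including the empty set), so the description operator is well defined.  The homogeneous
  attractor is the case \<open>C = {}\<close>.
\<close>

definition attractor :: "nat \<Rightarrow> (nat \<Rightarrow> real^'n \<Rightarrow> real^'n) \<Rightarrow> (real^'n) set \<Rightarrow> (real^'n) set" where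
  "attractor N S C = (THE F. compact F \<and> F \<noteq> {} \<and> F = (\<Union>i\<in>{1..N}. S i ` F) \<union> C)"

definition words :: "nat \<Rightarrow> nat \<Rightarrow> nat list set" where
  "words N k = {w. length w = k \<and> set w \<subseteq> {1..N}}"

definition word_map :: "(nat \<Rightarrow> 'a \<Rightarrow> 'a) \<Rightarrow> nat list \<Rightarrow> 'a \<Rightarrow> 'a" where
  "word_map S w = foldr (\<lambda>i f. S i \<circ> f) w id"

definition linear_part :: "(real^'n \<Rightarrow> real^'n) \<Rightarrow> real^'n^'n" where
  "linear_part T = matrix (\<lambda>x. T x - T 0)"

subsection \<open>Singular values and the affinity dimension\<close>

text \<open>
  The singular values of \<open>A\<close> are the square roots of the eigenvalues of \<open>A\<^sup>T A\<close>, listed in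
  decreasing order and repeated according to multiplicity.  Since \<open>A\<^sup>T A\<close> is symmetric, the
  multiplicity is the dimension of the eigenspace, and the list has length \<open>CARD('n)\<close>.
\<close>

definition gram_eigenspace :: "real^'n^'n \<Rightarrow> real \<Rightarrow> (real^'n) set" where
  "gram_eigenspace A \<mu> = {x. (transpose A ** A) *v x = \<mu> *\<^sub>R x}"

definition singular_values :: "real^'n^'n \<Rightarrow> real list" where
  "singular_values A =
     rev (sorted_list_of_multiset
       (\<Sum>\<mu>\<in>{\<mu>. \<exists>x. x \<noteq> 0 \<and> x \<in> gram_eigenspace A \<mu>}.
          replicate_mset (dim (gram_eigenspace A \<mu>)) (sqrt \<mu>)))"

text \<open>Singular values are numbered from 1.\<close>

definition singular_value :: "nat \<Rightarrow> real^'n^'n \<Rightarrow> real" where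
  "singular_value j A = singular_values A ! (j - 1)"

text \<open>
  The singular value function \<open>\<phi>\<^sup>t(A)\<close>, meaningful for \<open>t \<ge> 0\<close> only.  The integer \<open>m\<close> with
  \<open>m - 1 < t \<le> m\<close> is the ceiling of \<open>t\<close>.
\<close>

definition sv_function :: "real \<Rightarrow> real^'n^'n \<Rightarrow> real" where
  "sv_function t A =
     (if t = 0 then 1
      else if t \<le> real CARD('n) then
        (let m = nat \<lceil>t\<rceil> in
           (\<Prod>j=1..<m. singular_value j A) * singular_value m A powr (t - real m + 1))
      else \<bar>det A\<bar> powr (t / real CARD('n)))"

text \<open>
  The solution is unique for \<open>k \<ge> 1\<close>.  For \<open>k = 0\<close> the value is unspecified; this does not
  affect the limit.
\<close>

definition affinity_dim_approx :: "nat \<Rightarrow> (nat \<Rightarrow> real^'n \<Rightarrow> real^'n) \<Rightarrow> nat \<Rightarrow> real" where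
  "affinity_dim_approx N S k =
     (THE t. t \<ge> 0 \<and> (\<Sum>w\<in>words N k. sv_function t (linear_part (word_map S w))) = 1)"

definition affinity_dim :: "nat \<Rightarrow> (nat \<Rightarrow> real^'n \<Rightarrow> real^'n) \<Rightarrow> real" where
  "affinity_dim N S = lim (\<lambda>k. affinity_dim_approx N S k)"

subsection \<open>Upper box dimension\<close>

text \<open>Hypercubes are closed and axis-parallel, in arbitrary position.\<close>

definition hypercube :: "real^'n \<Rightarrow> real \<Rightarrow> (real^'n) set" where
  "hypercube a \<delta> = cbox a (a + (\<chi> i. \<delta>))"

definition covering_number :: "real \<Rightarrow> (real^'n) set \<Rightarrow> nat" where
  "covering_number \<delta> F =
     (LEAST m. \<exists>P. finite P \<and> card P = m \<and> (\<forall>Q\<in>P. \<exists>a. Q = hypercube a \<delta>) \<and> F \<subseteq> \<Union>P)"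

definition upper_box_dim :: "(real^'n) set \<Rightarrow> ereal" where
  "upper_box_dim F =
     Limsup (at_right 0) (\<lambda>\<delta>. ereal (ln (real (covering_number \<delta> F)) / (- ln \<delta>)))"

end

theory Submission
  imports Defs
begin

text \<open>The lower bound is monotonicity of the box dimension: \<open>F\<^sub>C\<close> contains \<open>C\<close>, and it contains
  \<open>F\<^sub>\<emptyset>\<close> because it is closed and mapped into itself by every \<open>S\<^sub>i\<close>
  (\<open>sub_attractor_subset_super_attractor\<close>).

  For the upper bound put \<open>h(d) = d\<^sup>t N\<^sub>d(F\<^sub>C)\<close>, where \<open>N\<^sub>d\<close> is the covering number, and
  \<open>f\<^sub>A(d) = \<Prod>\<^sub>i max(\<alpha>\<^sub>i(A)/d, 1)\<close>.  Up to a constant that depends on \<open>n\<close> only, \<open>f\<^sub>A(d)\<close> is the number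
  of cubes of side \<open>d\<close> needed to cover the image of a unit cube under \<open>A\<close>, because this image is
  comparable to a box with edges \<open>\<alpha>\<^sub>1, \<dots>, \<alpha>\<^sub>n\<close>.  For \<open>0 < t \<le> n\<close>,
  the singular value function \<open>\<phi>\<^sup>t(A)\<close> is the minimum of \<open>f\<^sub>A(d) d\<^sup>t\<close> over \<open>d > 0\<close>, and the
  minimum is attained at \<open>d = \<alpha>\<^sub>m\<close> with \<open>m = \<lceil>t\<rceil>\<close>.  This has two consequences.

  First, covering numbers of images under a product \<open>AB\<close> multiply, so \<open>\<phi>\<^sup>t\<close> is submultiplicative up
  to a constant (\<open>sv_function_mult_le\<close>).  Together with
  \<open>\<phi>\<^bsup>t'\<^esup>(S\<^sub>w) \<le> \<phi>\<^sup>t(S\<^sub>w) c\<^bsup>k(t'-t)\<^esup>\<close> for words \<open>w\<close> of length \<open>k\<close> and \<open>t \<le> t'\<close>, this shows that the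
  limit \<open>s\<close> of the \<open>s\<^sub>k\<close> exists (\<open>affinity_dim_limit\<close>), and that \<open>\<Sum>\<^sub>w \<phi>\<^sup>t(S\<^sub>w)\<close> over the words of
  length \<open>k\<close> tends to 0 whenever \<open>t > s\<close>.

  Second, covering \<open>F\<close> by cubes of side \<open>d/\<alpha>\<^sub>m(S\<^sub>w)\<close> and mapping them by \<open>S\<^sub>w\<close> gives
  \<open>d\<^sup>t N\<^sub>d(S\<^sub>w F) \<le> K \<phi>\<^sup>t(S\<^sub>w) h(d/\<alpha>\<^sub>m(S\<^sub>w))\<close>.  Since \<open>F\<^sub>C\<close> is the union of its images under the words of
  length \<open>k\<close> and of finitely many affine copies of \<open>C\<close>,
  \<open>h(d) \<le> \<Sum>\<^sub>w K \<phi>\<^sup>t(S\<^sub>w) h(d/\<alpha>\<^sub>m(S\<^sub>w)) + M d\<^sup>t N\<^sub>d(C)\<close>.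
  If \<open>t\<close> exceeds \<open>s\<close> and the upper box dimension of \<open>C\<close>, then \<open>k\<close> can be chosen with
  \<open>\<Sum>\<^sub>w K \<phi>\<^sup>t(S\<^sub>w) < 1/2\<close>, and the last term is bounded.  The right-hand side involves \<open>h\<close> only at scales
  larger than \<open>d\<close> by a factor of at least \<open>1/c\<close>, so \<open>h\<close> is bounded by induction over scales
  (\<open>attractor_covering_bound\<close>), and the box dimension of \<open>F\<^sub>C\<close> is at most \<open>t\<close>.  For \<open>t \<ge> n\<close> the same
  conclusion holds because no bounded set has box dimension above \<open>n\<close>.\<close>

section \<open>Spectral theorem and singular value decomposition\<close>

text \<open>The quadratic form of \<open>T\<close> is minimal at \<open>u\<close>, so its first variation vanishes in every direction
  \<open>z\<close> of the subspace.\<close>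

lemma psd_null_vector:
  fixes T :: "'a::real_inner \<Rightarrow> 'a"
  assumes lin: "linear T" and sym: "\<And>x y. T x \<bullet> y = x \<bullet> T y"
    and V: "subspace V" "u \<in> V" "z \<in> V"
    and psd: "\<And>x. x \<in> V \<Longrightarrow> 0 \<le> T x \<bullet> x"
    and null: "T u \<bullet> u = 0"
  shows "T u \<bullet> z = 0"
proof (rule ccontr)
  assume nz: "T u \<bullet> z \<noteq> 0"
  define p q where "p = T u \<bullet> z" and "q = T z \<bullet> z"
  have q0: "0 \<le> q" using psd[OF V(3)] by (simp add: q_def)
  have expand: "0 \<le> 2 * e * p + e\<^sup>2 * q" for e
  proof -
    have "u + e *\<^sub>R z \<in> V" using V by (simp add: subspace_add subspace_mul)
    then have "0 \<le> T (u + e *\<^sub>R z) \<bullet> (u + e *\<^sub>R z)" by (rule psd)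
    also have "\<dots> = 2 * e * p + e\<^sup>2 * q"
      using null sym[of z u]
      by (simp add: linear_add[OF lin] linear_cmul[OF lin] inner_add_left inner_add_right
          p_def q_def power2_eq_square inner_commute algebra_simps)
    finally show ?thesis .
  qed
  \<comment> \<open>With \<open>q + 1\<close> in place of \<open>q\<close>, the minimising step also makes sense for \<open>q = 0\<close>.\<close>
  have "0 \<le> 2 * (- p / (q + 1)) * p + (- p / (q + 1))\<^sup>2 * q" by (rule expand)
  also have "\<dots> = - (p\<^sup>2 * (q + 2) / (q + 1)\<^sup>2)"
    using q0 by (simp add: divide_simps power2_eq_square) (simp add: algebra_simps)
  also have "\<dots> < 0" using nz q0 by (simp add: p_def)
  finally show False by simp
qed

text \<open>A maximiser \<open>u\<close> of the quadratic form on the unit sphere is an eigenvector: with the maximum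
  \<open>\<mu>\<close>, the operator \<open>\<mu> - T\<close> is positive semidefinite and its form vanishes at \<open>u\<close>, hence
  \<open>(\<mu> - T) u\<close> is orthogonal to all of \<open>V\<close>, itself included.\<close>

lemma symmetric_eigenvector_exists:
  fixes T :: "'a::euclidean_space \<Rightarrow> 'a"
  assumes lin: "linear T" and sym: "\<And>x y. T x \<bullet> y = x \<bullet> T y"
    and V: "subspace V" "V \<noteq> {0}" and inv: "T ` V \<subseteq> V"
  obtains u \<mu> where "u \<in> V" "norm u = 1" "T u = \<mu> *\<^sub>R u"
proof -
  define K where "K = V \<inter> sphere 0 1"
  have cK: "compact K"
    unfolding K_def by (intro closed_Int_compact closed_subspace V compact_sphere)
  obtain a where a: "a \<in> V" "a \<noteq> 0" using V subspace_0 by blast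
  have neK: "K \<noteq> {}"
  proof -
    have "a /\<^sub>R norm a \<in> K" using a V by (simp add: K_def subspace_mul)
    then show ?thesis by blast
  qed
  have cont: "continuous_on K (\<lambda>x. T x \<bullet> x)"
    using lin by (intro continuous_intros linear_continuous_on linear_conv_bounded_linear[THEN iffD1])
  obtain u where u: "u \<in> K" and max: "\<And>x. x \<in> K \<Longrightarrow> T x \<bullet> x \<le> T u \<bullet> u"
    using continuous_attains_sup[OF cK neK cont] by blast
  define \<mu> where "\<mu> = T u \<bullet> u"
  have uV: "u \<in> V" and u1: "norm u = 1" using u by (auto simp: K_def)
  have bound: "T x \<bullet> x \<le> \<mu> * (x \<bullet> x)" if "x \<in> V" for x
  proof (cases "x = 0")
    case True
    then show ?thesis using linear_0[OF lin] by simp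
  next
    case False
    have "x /\<^sub>R norm x \<in> K" using False that V by (simp add: K_def subspace_mul)
    from max[OF this] have "(T x \<bullet> x) / (norm x)\<^sup>2 \<le> \<mu>"
      by (simp add: linear_cmul[OF lin] \<mu>_def power2_eq_square divide_inverse algebra_simps)
    then show ?thesis using False by (simp add: divide_simps dot_square_norm split: if_splits)
  qed
  define R where "R = (\<lambda>x. \<mu> *\<^sub>R x - T x)"
  have linR: "linear R" unfolding R_def
    using lin by (intro linear_compose_sub linear_scaleR) auto
  have symR: "R x \<bullet> y = x \<bullet> R y" for x y by (simp add: R_def inner_diff_left inner_diff_right sym)
  have RV: "R u \<in> V"
    using uV inv V by (auto simp: R_def intro!: subspace_diff subspace_mul)
  have "R u \<bullet> R u = 0"
  proof (rule psd_null_vector[OF linR symR V(1) uV RV])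
    show "0 \<le> R x \<bullet> x" if "x \<in> V" for x
      using bound[OF that] by (simp add: R_def inner_diff_left)
    show "R u \<bullet> u = 0" using u1 by (simp add: R_def inner_diff_left \<mu>_def dot_square_norm)
  qed
  then have "T u = \<mu> *\<^sub>R u" by (simp add: R_def)
  then show thesis using that uV u1 by blast
qed

text \<open>Induction on the dimension: the orthogonal complement of an eigenvector is again invariant.\<close>

lemma symmetric_eigenbasis:
  fixes T :: "'a::euclidean_space \<Rightarrow> 'a"
  assumes lin: "linear T" and sym: "\<And>x y. T x \<bullet> y = x \<bullet> T y"
    and "subspace V" "T ` V \<subseteq> V"
  shows "\<exists>B. B \<subseteq> V \<and> pairwise orthogonal B \<and> (\<forall>b\<in>B. norm b = 1 \<and> (\<exists>\<mu>. T b = \<mu> *\<^sub>R b))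
          \<and> V \<subseteq> span B"
  using assms(3,4)
proof (induction "dim V" arbitrary: V rule: less_induct)
  case (less V)
  show ?case
  proof (cases "V = {0}")
    case True
    then show ?thesis by (intro exI[of _ "{}"]) auto
  next
    case False
    obtain u \<mu> where u: "u \<in> V" "norm u = 1" "T u = \<mu> *\<^sub>R u"
      using symmetric_eigenvector_exists[OF lin sym less.prems(1) False less.prems(2)] .
    define W where "W = {x \<in> V. u \<bullet> x = 0}"
    have sW: "subspace W"
      using less.prems(1) unfolding W_def subspace_def by (simp add: inner_add_right)
    have TW: "T ` W \<subseteq> W"
      using less.prems(2) by (auto simp: W_def sym[symmetric] u(3))
    have "u \<notin> W" using u by (auto simp: W_def)
    then have "W \<subset> V" using u(1) W_def by blast
    then have "dim W < dim V"
      using dim_psubset[of W V] sW less.prems(1) by (simp add: span_eq_iff[THEN iffD2])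
    from less.hyps[OF this sW TW] obtain B where B: "B \<subseteq> W" "pairwise orthogonal B"
      "\<forall>b\<in>B. norm b = 1 \<and> (\<exists>\<mu>. T b = \<mu> *\<^sub>R b)" "W \<subseteq> span B" by blast
    have "V \<subseteq> span (insert u B)"
    proof
      fix x assume x: "x \<in> V"
      have "x - (u \<bullet> x) *\<^sub>R u \<in> W"
        using x u less.prems(1)
        by (simp add: W_def subspace_diff subspace_mul inner_diff_right dot_square_norm)
      then have "x - (u \<bullet> x) *\<^sub>R u \<in> span B" using B(4) by blast
      then show "x \<in> span (insert u B)" using span_breakdown_eq by blast
    qed
    moreover have "pairwise orthogonal (insert u B)"
      using B(1,2) by (auto simp: pairwise_insert W_def orthogonal_def inner_commute)
    moreover have "insert u B \<subseteq> V" using B(1) u by (auto simp: W_def)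
    ultimately show ?thesis using B(3) u by (intro exI[of _ "insert u B"]) auto
  qed
qed

text \<open>Frames are indexed by natural numbers rather than by the type \<open>'n\<close>, so that their indices match
  the positions in the decreasing list of singular values.\<close>

definition orthonormal_frame :: "(nat \<Rightarrow> real^'n) \<Rightarrow> bool" where
  "orthonormal_frame u \<longleftrightarrow>
     (\<forall>i<CARD('n). \<forall>j<CARD('n). u i \<bullet> u j = (if i = j then 1 else 0))"

lemma orthonormal_frame_norm_sum:
  fixes u :: "nat \<Rightarrow> real^'n"
  assumes "orthonormal_frame u"
  shows "(norm (\<Sum>i<CARD('n). c i *\<^sub>R u i))\<^sup>2 = (\<Sum>i<CARD('n). (c i)\<^sup>2)"
proof -
  have "(norm (\<Sum>i<CARD('n). c i *\<^sub>R u i))\<^sup>2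
      = (\<Sum>i<CARD('n). \<Sum>j<CARD('n). c i * (c j * (u i \<bullet> u j)))"
    by (simp only: power2_norm_eq_inner inner_sum_left)
       (simp add: inner_sum_right sum_distrib_left mult.left_commute)
  also have "\<dots> = (\<Sum>i<CARD('n). \<Sum>j<CARD('n). if i = j then c i * c j else 0)"
    using assms by (intro sum.cong refl) (auto simp: orthonormal_frame_def)
  finally show ?thesis by (simp add: power2_eq_square)
qed

lemma orthonormal_frame_expand:
  fixes u :: "nat \<Rightarrow> real^'n"
  assumes u: "orthonormal_frame u"
  shows "x = (\<Sum>i<CARD('n). (x \<bullet> u i) *\<^sub>R u i)"
proof -
  have inner: "u i \<bullet> u j = (if i = j then 1 else 0)" if "i < CARD('n)" "j < CARD('n)" for i j
    using u that by (auto simp: orthonormal_frame_def)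
  have inj: "inj_on u {..<CARD('n)}"
    by (rule inj_onI) (metis inner lessThan_iff zero_neq_one)
  define B where "B = u ` {..<CARD('n)}"
  have "0 \<notin> B" using inner by (fastforce simp: B_def)
  moreover have "pairwise orthogonal B"
    using inner by (auto simp: pairwise_def B_def orthogonal_def)
  ultimately have "independent B" by (rule pairwise_orthogonal_independent[rotated])
  moreover have "card B = CARD('n)" using inj by (simp add: B_def card_image)
  ultimately have "UNIV \<subseteq> span B"
    using card_ge_dim_independent[of B UNIV] by simp
  then have sp: "x - (\<Sum>i<CARD('n). (x \<bullet> u i) *\<^sub>R u i) \<in> span B" by blast
  have "orthogonal (x - (\<Sum>i<CARD('n). (x \<bullet> u i) *\<^sub>R u i)) y" if "y \<in> B" for y
  proof -
    obtain j where j: "j < CARD('n)" "y = u j" using \<open>y \<in> B\<close> by (auto simp: B_def)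
    have "(\<Sum>i<CARD('n). (x \<bullet> u i) *\<^sub>R u i) \<bullet> u j = (\<Sum>i<CARD('n). if i = j then x \<bullet> u i else 0)"
      by (auto simp: inner_sum_left inner j simp del: sum.delta sum.delta' intro!: sum.cong)
    then show ?thesis using j by (simp add: orthogonal_def inner_diff_left)
  qed
  then have "orthogonal (x - (\<Sum>i<CARD('n). (x \<bullet> u i) *\<^sub>R u i)) (x - (\<Sum>i<CARD('n). (x \<bullet> u i) *\<^sub>R u i))"
    using orthogonal_to_span[OF sp] by blast
  then show ?thesis by (simp add: orthogonal_self)
qed

lemma gram_symmetric:
  fixes A :: "real^'n^'n"
  shows "((transpose A ** A) *v x) \<bullet> y = (A *v x) \<bullet> (A *v y)"
  by (metis dot_lmul_matrix matrix_vector_mul_assoc transpose_matrix_vector transpose_transpose)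

text \<open>Each eigenspace of the Gram matrix is spanned by the members of an orthonormal eigenbasis that it
  contains.  The multiset of singular values is therefore the image of the eigenbasis under
  \<open>b \<mapsto> \<surd>\<lambda>\<^sub>b\<close>, and enumerating the basis by decreasing eigenvalue produces the list.\<close>

lemma singular_frame:
  fixes A :: "real^'n^'n"
  obtains u where "orthonormal_frame u" "length (singular_values A) = CARD('n)"
    "sorted_wrt (\<ge>) (singular_values A)"
    "\<And>i. i < CARD('n) \<Longrightarrow> (transpose A ** A) *v u i = (singular_values A ! i)\<^sup>2 *\<^sub>R u i"
    "\<And>i. i < CARD('n) \<Longrightarrow> 0 \<le> singular_values A ! i"
proof -
  define T where "T = (\<lambda>x. (transpose A ** A) *v x)"
  have linT: "linear T" by (simp add: T_def)
  have symT: "T x \<bullet> y = x \<bullet> T y" for x y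
    unfolding T_def by (metis gram_symmetric inner_commute)
  obtain B where B: "pairwise orthogonal B" "\<forall>b\<in>B. norm b = 1 \<and> (\<exists>\<mu>. T b = \<mu> *\<^sub>R b)"
      "UNIV \<subseteq> span B"
    using symmetric_eigenbasis[OF linT symT subspace_UNIV] by auto
  have "0 \<notin> B" using B(2) by force
  then have indB: "independent B" using B(1) by (rule pairwise_orthogonal_independent[rotated])
  then have finB: "finite B" by (rule independent_imp_finite)
  have spanB: "span B = UNIV" using B(3) by blast
  have cardB: "card B = CARD('n)"
    using dim_span_eq_card_independent[OF indB] spanB by simp
  obtain ev where ev: "\<And>b. b \<in> B \<Longrightarrow> T b = ev b *\<^sub>R b" using B(2) by metis
  have inner: "b \<bullet> b' = (if b = b' then 1 else 0)" if "b \<in> B" "b' \<in> B" for b b'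
    using B(1,2) that by (auto simp: pairwise_def orthogonal_def dot_square_norm)
  have ev_nonneg: "0 \<le> ev b" if "b \<in> B" for b
  proof -
    have "ev b = T b \<bullet> b" using ev[OF that] inner[OF that that] by simp
    also have "\<dots> = (A *v b) \<bullet> (A *v b)" by (simp add: T_def gram_symmetric)
    finally show ?thesis by simp
  qed
  have eigspace: "gram_eigenspace A \<mu> = span {b\<in>B. ev b = \<mu>}" for \<mu>
  proof
    have "subspace (gram_eigenspace A \<mu>)"
      by (auto simp: subspace_def gram_eigenspace_def matrix_vector_right_distrib
          matrix_vector_mult_scaleR scaleR_right_distrib)
    moreover have "{b\<in>B. ev b = \<mu>} \<subseteq> gram_eigenspace A \<mu>"
      using ev by (auto simp: gram_eigenspace_def T_def)
    ultimately show "span {b\<in>B. ev b = \<mu>} \<subseteq> gram_eigenspace A \<mu>" by (rule span_minimal[rotated])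
  next
    show "gram_eigenspace A \<mu> \<subseteq> span {b\<in>B. ev b = \<mu>}"
    proof
      fix x assume "x \<in> gram_eigenspace A \<mu>"
      then have Tx: "T x = \<mu> *\<^sub>R x" by (simp add: gram_eigenspace_def T_def)
      have zero: "x \<bullet> b = 0" if "b \<in> B" "ev b \<noteq> \<mu>" for b
      proof -
        have "\<mu> * (x \<bullet> b) = ev b * (x \<bullet> b)"
          using symT[of x b] by (simp add: Tx ev[OF that(1)])
        then show ?thesis using that by simp
      qed
      have "x = (\<Sum>b\<in>B. (x \<bullet> b) *\<^sub>R b)"
      proof -
        have "orthogonal (x - (\<Sum>b\<in>B. (x \<bullet> b) *\<^sub>R b)) y" if "y \<in> B" for y
        proof -
          have "(\<Sum>b\<in>B. (x \<bullet> b) *\<^sub>R b) \<bullet> y = (\<Sum>b\<in>B. if b = y then x \<bullet> b else 0)"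
            by (auto simp: inner_sum_left inner that intro!: sum.cong)
          then show ?thesis using that finB by (simp add: orthogonal_def inner_diff_left)
        qed
        then have "orthogonal (x - (\<Sum>b\<in>B. (x \<bullet> b) *\<^sub>R b)) (x - (\<Sum>b\<in>B. (x \<bullet> b) *\<^sub>R b))"
          using orthogonal_to_span[of "x - (\<Sum>b\<in>B. (x \<bullet> b) *\<^sub>R b)" B] spanB by blast
        then show ?thesis by (simp add: orthogonal_self)
      qed
      also have "\<dots> = (\<Sum>b\<in>{b\<in>B. ev b = \<mu>}. (x \<bullet> b) *\<^sub>R b)"
        using finB zero by (intro sum.mono_neutral_right) auto
      also have "\<dots> \<in> span {b\<in>B. ev b = \<mu>}" by (intro span_sum span_mul span_base)
      finally show "x \<in> span {b\<in>B. ev b = \<mu>}" .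
    qed
  qed
  have dimeig: "dim (gram_eigenspace A \<mu>) = card {b\<in>B. ev b = \<mu>}" for \<mu>
    unfolding eigspace
    by (rule dim_span_eq_card_independent, rule independent_mono[OF indB]) auto
  have replicate_mset_card: "replicate_mset (card I) x = (\<Sum>b\<in>I. {#x#})"
    if "finite I" for I :: "(real^'n) set" and x :: real
    using that by induction auto
  have eigs: "{\<mu>. \<exists>x. x \<noteq> 0 \<and> x \<in> gram_eigenspace A \<mu>} = ev ` B"
  proof (intro equalityI subsetI)
    fix \<mu> assume "\<mu> \<in> {\<mu>. \<exists>x. x \<noteq> 0 \<and> x \<in> gram_eigenspace A \<mu>}"
    then obtain x where x: "x \<noteq> 0" "x \<in> span {b\<in>B. ev b = \<mu>}" by (auto simp: eigspace)
    then have "{b\<in>B. ev b = \<mu>} \<noteq> {}" by (metis empty_iff insert_iff span_empty)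
    then show "\<mu> \<in> ev ` B" by blast
  next
    fix \<mu> assume "\<mu> \<in> ev ` B"
    then obtain b where "b \<in> B" "\<mu> = ev b" by blast
    then show "\<mu> \<in> {\<mu>. \<exists>x. x \<noteq> 0 \<and> x \<in> gram_eigenspace A \<mu>}"
      using \<open>0 \<notin> B\<close> by (auto simp: eigspace intro!: exI[of _ b] span_base)
  qed
  have "(\<Sum>\<mu>\<in>ev ` B. replicate_mset (dim (gram_eigenspace A \<mu>)) (sqrt \<mu>))
      = (\<Sum>\<mu>\<in>ev ` B. \<Sum>b\<in>{b\<in>B. ev b = \<mu>}. {#sqrt (ev b)#})"
    using finB by (intro sum.cong refl) (simp add: dimeig replicate_mset_card)
  also have "\<dots> = (\<Sum>b\<in>B. {#sqrt (ev b)#})"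
    using finB by (intro sum.group) auto
  also have "\<dots> = image_mset (\<lambda>b. sqrt (ev b)) (mset_set B)"
    using finB by (induction B) auto
  finally have mset: "singular_values A
      = rev (sorted_list_of_multiset (image_mset (\<lambda>b. sqrt (ev b)) (mset_set B)))"
    by (simp add: singular_values_def eigs)
  obtain bs where bs: "mset bs = mset_set B" "map (\<lambda>b. sqrt (ev b)) bs = singular_values A"
  proof -
    obtain bs0 where bs0: "mset bs0 = mset_set B" using ex_mset by blast
    define bs where "bs = rev (sort_key (\<lambda>b. sqrt (ev b)) bs0)"
    let ?xs = "map (\<lambda>b. sqrt (ev b)) (sort_key (\<lambda>b. sqrt (ev b)) bs0)"
    have "image_mset (\<lambda>b. sqrt (ev b)) (mset_set B) = mset ?xs" by (simp add: bs0)
    moreover have "sort ?xs = ?xs" by (intro sorted_sort_id) simp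
    ultimately have "?xs = sorted_list_of_multiset (image_mset (\<lambda>b. sqrt (ev b)) (mset_set B))"
      by (simp only: sorted_list_of_multiset_mset)
    then have "map (\<lambda>b. sqrt (ev b)) bs = singular_values A" by (simp add: bs_def mset rev_map[symmetric])
    then show thesis using that[of bs] bs0 by (simp add: bs_def)
  qed
  have setbs: "set bs = B" using bs(1) finB by (metis finite_set_mset_mset_set set_mset_mset)
  have lenbs: "length bs = CARD('n)" using bs(1) cardB by (metis size_mset size_mset_set)
  have distbs: "distinct bs" using setbs lenbs cardB by (simp add: card_distinct)
  have sv: "singular_values A ! i = sqrt (ev (bs ! i))" if "i < CARD('n)" for i
    using that lenbs bs(2) by (metis nth_map)
  have inB: "bs ! i \<in> B" if "i < CARD('n)" for i
    using that lenbs setbs nth_mem by metis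
  show thesis
  proof (rule that[of "\<lambda>i. bs ! i"])
    show "orthonormal_frame (\<lambda>i. bs ! i)"
      using inner inB distbs lenbs by (auto simp: orthonormal_frame_def nth_eq_iff_index_eq)
    show "length (singular_values A) = CARD('n)" using bs(2) lenbs by (metis length_map)
    show "sorted_wrt (\<ge>) (singular_values A)"
      unfolding mset using sorted_wrt_rev[of "(\<ge>)"] by (simp add: sorted_wrt_rev)
    show "(transpose A ** A) *v bs ! i = (singular_values A ! i)\<^sup>2 *\<^sub>R bs ! i" if "i < CARD('n)" for i
      using ev[OF inB[OF that]] ev_nonneg[OF inB[OF that]] sv[OF that] by (simp add: T_def)
    show "0 \<le> singular_values A ! i" if "i < CARD('n)" for i
      using ev_nonneg[OF inB[OF that]] sv[OF that] by simp
  qed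
qed

lemma singular_values_length [simp]:
  fixes A :: "real^'n^'n"
  shows "length (singular_values A) = CARD('n)"
  using singular_frame[of A] by metis

text \<open>Diagonalising the Gram matrix gives \<open>(det A)\<^sup>2 = det (A\<^sup>T A) = \<Prod>\<^sub>i \<alpha>\<^sub>i\<^sup>2\<close>.\<close>

lemma prod_singular_values:
  fixes A :: "real^'n^'n"
  shows "(\<Prod>i<CARD('n). singular_values A ! i) = \<bar>det A\<bar>"
proof -
  obtain u where u: "orthonormal_frame u"
    "\<And>i. i < CARD('n) \<Longrightarrow> (transpose A ** A) *v u i = (singular_values A ! i)\<^sup>2 *\<^sub>R u i"
    "\<And>i. i < CARD('n) \<Longrightarrow> 0 \<le> singular_values A ! i"
    using singular_frame[of A] by metis
  obtain g where g: "bij_betw g (UNIV :: 'n set) {..<CARD('n)}"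
    using ex_bij_betw_finite_nat[OF finite_class.finite_UNIV] by (metis atLeast0LessThan)
  have gl: "g i < CARD('n)" for i using g by (auto simp: bij_betw_def)
  have gi: "g i = g j \<longleftrightarrow> i = j" for i j using g by (auto simp: bij_betw_def inj_on_def)
  define P :: "real^'n^'n" where "P = (\<chi> i j. u (g j) $ i)"
  define D :: "real^'n^'n" where "D = (\<chi> i j. if i = j then (singular_values A ! g i)\<^sup>2 else 0)"
  have colP: "column j P = u (g j)" for j by (simp add: P_def column_def vec_eq_iff)
  have orth: "orthogonal_matrix P"
    unfolding orthogonal_matrix_orthonormal_columns
    using u(1) gl gi by (auto simp: colP orthonormal_frame_def orthogonal_def norm_eq_1)
  have "(transpose A ** A) ** P = P ** D"
  proof -
    have "((transpose A ** A) ** P) $ i $ j = (P ** D) $ i $ j" for i j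
    proof -
      have "((transpose A ** A) ** P) $ i $ j = ((transpose A ** A) *v u (g j)) $ i"
        by (simp add: matrix_matrix_mult_def matrix_vector_mult_def P_def)
      also have "\<dots> = (singular_values A ! g j)\<^sup>2 * u (g j) $ i" by (simp add: u(2) gl)
      also have "\<dots> = (\<Sum>k\<in>UNIV. if k = j then u (g k) $ i * (singular_values A ! g k)\<^sup>2 else 0)"
        by simp
      also have "\<dots> = (P ** D) $ i $ j"
        unfolding matrix_matrix_mult_def P_def D_def
        by (simp add: if_distrib[of "\<lambda>x. _ * x"] cong: if_cong)
      finally show ?thesis .
    qed
    then show ?thesis by (simp add: vec_eq_iff)
  qed
  then have "det (transpose A ** A) * det P = det P * det D" by (metis det_mul)
  moreover have "det P \<noteq> 0" using det_orthogonal_matrix[OF orth] by auto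
  ultimately have "(det A)\<^sup>2 = det D" by (simp add: det_mul power2_eq_square)
  also have "det D = (\<Prod>i\<in>UNIV. (singular_values A ! g i)\<^sup>2)"
    by (subst det_diagonal) (auto simp: D_def)
  also have "\<dots> = (\<Prod>i<CARD('n). (singular_values A ! i)\<^sup>2)"
    using g by (rule prod.reindex_bij_betw)
  also have "\<dots> = (\<Prod>i<CARD('n). singular_values A ! i)\<^sup>2" by (simp add: prod_power_distrib)
  finally have "\<bar>det A\<bar> = \<bar>\<Prod>i<CARD('n). singular_values A ! i\<bar>" by (simp add: power2_eq_iff abs_eq_iff)
  moreover have "0 \<le> (\<Prod>i<CARD('n). singular_values A ! i)" using u(3) by (intro prod_nonneg) auto
  ultimately show ?thesis by simp
qed

lemma singular_values_antimono:
  fixes A :: "real^'n^'n"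
  assumes "i \<le> j" "j < CARD('n)"
  shows "singular_values A ! j \<le> singular_values A ! i"
proof -
  have "sorted_wrt (\<ge>) (singular_values A)" using singular_frame[of A] by metis
  then show ?thesis using assms by (cases "i = j") (auto simp: sorted_wrt_iff_nth_less)
qed

lemma singular_values_pos:
  fixes A :: "real^'n^'n"
  assumes "invertible A" "i < CARD('n)"
  shows "0 < singular_values A ! i"
proof -
  have "0 \<le> singular_values A ! i" using singular_frame[of A] assms(2) by metis
  moreover have "singular_values A ! i \<noteq> 0"
  proof
    assume "singular_values A ! i = 0"
    then have "(\<Prod>i<CARD('n). singular_values A ! i) = 0" using assms(2) by (auto simp: prod_zero_iff)
    then show False using prod_singular_values[of A] invertible_det_nz[of A] assms(1) by simp
  qed
  ultimately show ?thesis by simp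
qed

lemma singular_values_nonzero:
  fixes A :: "real^'n^'n"
  assumes "invertible A" "i < CARD('n)"
  shows "singular_values A ! i \<noteq> 0"
  using singular_values_pos[OF assms] by simp

lemma singular_value_decomposition:
  fixes A :: "real^'n^'n"
  assumes "invertible A"
  obtains u v where "orthonormal_frame u" "orthonormal_frame v"
    "\<And>i. i < CARD('n) \<Longrightarrow> A *v u i = (singular_values A ! i) *\<^sub>R v i"
proof -
  obtain u where u: "orthonormal_frame u"
    "\<And>i. i < CARD('n) \<Longrightarrow> (transpose A ** A) *v u i = (singular_values A ! i)\<^sup>2 *\<^sub>R u i"
    using singular_frame[of A] by metis
  let ?a = "\<lambda>i. singular_values A ! i"
  note pos = singular_values_pos[OF assms]
  have ui: "u i \<bullet> u j = (if i = j then 1 else 0)" if "i < CARD('n)" "j < CARD('n)" for i j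
    using u(1) that by (auto simp: orthonormal_frame_def)
  define v where "v = (\<lambda>i. (A *v u i) /\<^sub>R ?a i)"
  have "v i \<bullet> v j = (if i = j then 1 else 0)" if "i < CARD('n)" "j < CARD('n)" for i j
  proof -
    have "(A *v u i) \<bullet> (A *v u j) = (?a i)\<^sup>2 * (u i \<bullet> u j)"
      by (simp add: gram_symmetric[symmetric] u(2) that)
    then have "v i \<bullet> v j = (?a i)\<^sup>2 * (u i \<bullet> u j) / (?a i * ?a j)"
      by (simp add: v_def divide_inverse)
    then show ?thesis using pos[OF that(1)] pos[OF that(2)] ui[OF that] by (simp add: power2_eq_square)
  qed
  then have "orthonormal_frame v" by (simp add: orthonormal_frame_def)
  moreover have "A *v u i = ?a i *\<^sub>R v i" if "i < CARD('n)" for i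
    using pos[OF that] by (simp add: v_def)
  ultimately show thesis using that u(1) by blast
qed

lemma singular_values_le:
  fixes A :: "real^'n^'n"
  assumes A: "invertible A" and c: "\<And>x. norm (A *v x) \<le> c * norm x" and i: "i < CARD('n)"
  shows "singular_values A ! i \<le> c"
proof -
  obtain u v where uv: "orthonormal_frame u" "orthonormal_frame v"
    "\<And>i. i < CARD('n) \<Longrightarrow> A *v u i = (singular_values A ! i) *\<^sub>R v i"
    using singular_value_decomposition[OF A] by blast
  have "norm (u i) = 1" "norm (v i) = 1"
    using uv(1,2) i by (simp_all add: orthonormal_frame_def norm_eq_1)
  then show ?thesis using c[of "u i"] uv(3)[OF i] singular_values_pos[OF A i] by simp
qed

section \<open>The singular value function\<close>

text \<open>The exponent of \<open>\<alpha>\<^sub>i\<close> (counted from 0) in \<open>\<phi>\<^sup>t\<close> is \<open>unit_clamp (t - i)\<close>.\<close>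

definition unit_clamp :: "real \<Rightarrow> real" where
  "unit_clamp x = max 0 (min 1 x)"

lemma sum_unit_clamp:
  assumes "0 \<le> t"
  shows "(\<Sum>i<n. unit_clamp (t - real i)) = min t (real n)"
  using assms by (induction n) (auto simp: unit_clamp_def)

text \<open>A single formula for the three cases of the definition of \<open>\<phi>\<^sup>t\<close>.  Each factor has an exponent that is
  continuous and nondecreasing in \<open>t\<close>, so that continuity and decay of \<open>\<phi>\<^sup>t\<close> can be shown factor by factor.\<close>

lemma sv_function_eq:
  fixes A :: "real^'n^'n"
  assumes A: "invertible A" and t: "0 \<le> t"
  shows "sv_function t A = (\<Prod>i<CARD('n). singular_values A ! i powr unit_clamp (t - real i))
           * \<bar>det A\<bar> powr max 0 (t / real CARD('n) - 1)"
proof -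
  let ?n = "CARD('n)" and ?a = "\<lambda>i. singular_values A ! i"
  note pos = singular_values_pos[OF A]
  have det: "\<bar>det A\<bar> > 0" using A by (simp add: invertible_det_nz)
  consider "t = 0" | "0 < t" "t \<le> real ?n" | "real ?n < t" using t by linarith
  then show ?thesis
  proof cases
    case 1
    have "(\<Prod>i<?n. ?a i powr unit_clamp (t - real i)) = (\<Prod>i<?n. 1)"
      using singular_values_nonzero[OF A] by (intro prod.cong refl) (auto simp: 1 unit_clamp_def)
    then show ?thesis using 1 det by (simp add: sv_function_def)
  next
    case 2
    define m where "m = nat \<lceil>t\<rceil>"
    have m: "real m - 1 < t" "t \<le> real m" "1 \<le> m" "m \<le> ?n"
      using 2 unfolding m_def by linarith+
    have "(\<Prod>i<?n. ?a i powr unit_clamp (t - real i))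
        = (\<Prod>i<m - 1. ?a i powr unit_clamp (t - real i))
        * (\<Prod>i\<in>{m - 1..<?n}. ?a i powr unit_clamp (t - real i))"
      using m by (subst prod.union_disjoint[symmetric]) (auto intro!: prod.cong)
    also have "(\<Prod>i<m - 1. ?a i powr unit_clamp (t - real i)) = (\<Prod>i<m - 1. ?a i)"
    proof (intro prod.cong refl)
      fix i assume "i \<in> {..<m - 1}"
      then have "unit_clamp (t - real i) = 1" "i < ?n" using m by (auto simp: unit_clamp_def)
      then show "?a i powr unit_clamp (t - real i) = ?a i" using pos[of i] by simp
    qed
    also have "\<dots> = (\<Prod>j=1..<m. singular_value j A)"
      by (rule prod.reindex_bij_witness[of _ "\<lambda>j. j - 1" Suc]) (auto simp: singular_value_def)
    also have "(\<Prod>i\<in>{m - 1..<?n}. ?a i powr unit_clamp (t - real i))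
        = ?a (m - 1) powr unit_clamp (t - real (m - 1)) * (\<Prod>i\<in>{m..<?n}. ?a i powr unit_clamp (t - real i))"
      using m by (subst prod.atLeast_Suc_lessThan) auto
    also have "(\<Prod>i\<in>{m..<?n}. ?a i powr unit_clamp (t - real i)) = (\<Prod>i\<in>{m..<?n}. 1)"
    proof (intro prod.cong refl)
      fix i assume "i \<in> {m..<?n}"
      then have "unit_clamp (t - real i) = 0" "i < ?n" using m by (auto simp: unit_clamp_def)
      then show "?a i powr unit_clamp (t - real i) = 1" using pos[of i] by simp
    qed
    also have "unit_clamp (t - real (m - 1)) = t - real m + 1"
      using m by (auto simp: unit_clamp_def of_nat_diff)
    finally have "(\<Prod>i<?n. ?a i powr unit_clamp (t - real i))
        = (\<Prod>j=1..<m. singular_value j A) * singular_value m A powr (t - real m + 1)"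
      by (simp add: singular_value_def)
    moreover have "max 0 (t / real ?n - 1) = 0" using 2 by (simp add: divide_simps)
    ultimately show ?thesis using 2 det by (simp add: sv_function_def m_def[symmetric] Let_def)
  next
    case 3
    have "(\<Prod>i<?n. ?a i powr unit_clamp (t - real i)) = (\<Prod>i<?n. ?a i)"
    proof (intro prod.cong refl)
      fix i assume "i \<in> {..<?n}"
      then have "unit_clamp (t - real i) = 1" "i < ?n" using 3 by (auto simp: unit_clamp_def)
      then show "?a i powr unit_clamp (t - real i) = ?a i" using pos[of i] by simp
    qed
    also have "\<dots> = \<bar>det A\<bar> powr 1" using det by (simp add: prod_singular_values)
    also have "max 0 (t / real ?n - 1) = t / real ?n - 1" using 3 by simp
    ultimately have "(\<Prod>i<?n. ?a i powr unit_clamp (t - real i)) * \<bar>det A\<bar> powr max 0 (t / real ?n - 1)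
        = \<bar>det A\<bar> powr (1 + (t / real ?n - 1))"
      by (simp only: powr_add)
    then show ?thesis using 3 t by (simp add: sv_function_def)
  qed
qed

lemma sv_function_pos:
  fixes A :: "real^'n^'n"
  assumes "invertible A" "0 \<le> t"
  shows "0 < sv_function t A"
  using assms singular_values_pos[OF assms(1)]
  by (auto simp: sv_function_eq invertible_det_nz less_imp_neq[THEN not_sym] intro!: mult_pos_pos prod_pos)

lemma sv_function_zero [simp]: "sv_function 0 A = 1"
  by (simp add: sv_function_def)

lemma continuous_on_sv_function:
  fixes A :: "real^'n^'n"
  assumes "invertible A"
  shows "continuous_on {0..} (\<lambda>t. sv_function t A)"
proof -
  have "continuous_on {0..} (\<lambda>t. (\<Prod>i<CARD('n). singular_values A ! i powr unit_clamp (t - real i))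
           * \<bar>det A\<bar> powr max 0 (t / real CARD('n) - 1))"
    unfolding unit_clamp_def
    using singular_values_nonzero[OF assms] assms
    by (intro continuous_intros) (auto simp: invertible_det_nz)
  then show ?thesis
    by (rule continuous_on_eq) (simp add: sv_function_eq[OF assms])
qed

text \<open>When \<open>t\<close> grows to \<open>t'\<close>, the exponents of the singular values (those of the determinant counted \<open>n\<close>
  times) grow by \<open>t' - t\<close> altogether, and each base is at most \<open>c\<close>.\<close>

lemma sv_function_decay:
  fixes A :: "real^'n^'n"
  assumes A: "invertible A" and c: "\<And>i. i < CARD('n) \<Longrightarrow> singular_values A ! i \<le> c"
    and t: "0 \<le> t" "t \<le> t'"
  shows "sv_function t' A \<le> sv_function t A * c powr (t' - t)"
proof -
  let ?n = "CARD('n)" and ?a = "\<lambda>i. singular_values A ! i"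
  let ?e = "\<lambda>t i. unit_clamp (t - real i)" and ?g = "\<lambda>t. max 0 (t / real ?n - 1)"
  note pos = singular_values_pos[OF A]
  have det: "\<bar>det A\<bar> > 0" using A by (simp add: invertible_det_nz)
  have c0: "0 < c" using pos[of 0] c[of 0] by simp
  have e: "?e t i \<le> ?e t' i" for i using t by (auto simp: unit_clamp_def)
  have g: "?g t \<le> ?g t'" using t by (intro max.mono diff_mono divide_right_mono) auto
  have 1: "?a i powr ?e t' i \<le> ?a i powr ?e t i * c powr (?e t' i - ?e t i)" if "i < ?n" for i
  proof -
    have "?a i powr ?e t' i = ?a i powr ?e t i * ?a i powr (?e t' i - ?e t i)"
      by (simp flip: powr_add)
    also have "\<dots> \<le> ?a i powr ?e t i * c powr (?e t' i - ?e t i)"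
      using pos[OF that] c[OF that] e[of i] by (intro mult_left_mono powr_mono2) auto
    finally show ?thesis .
  qed
  have "\<bar>det A\<bar> \<le> (\<Prod>i<?n. c)"
    unfolding prod_singular_values[symmetric] using pos c by (intro prod_mono) (auto intro: less_imp_le)
  then have detc: "\<bar>det A\<bar> \<le> c powr real ?n" using c0 by (simp add: powr_realpow)
  have "\<bar>det A\<bar> powr ?g t' = \<bar>det A\<bar> powr ?g t * \<bar>det A\<bar> powr (?g t' - ?g t)"
    by (simp flip: powr_add)
  also have "\<dots> \<le> \<bar>det A\<bar> powr ?g t * (c powr real ?n) powr (?g t' - ?g t)"
    using det detc g by (intro mult_left_mono powr_mono2) auto
  finally have 2: "\<bar>det A\<bar> powr ?g t' \<le> \<bar>det A\<bar> powr ?g t * c powr (real ?n * (?g t' - ?g t))"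
    by (simp add: powr_powr)
  have exps: "(\<Sum>i<?n. ?e t' i - ?e t i) + real ?n * (?g t' - ?g t) = t' - t"
  proof -
    have "real ?n * ?g s = max 0 (s - real ?n)" for s
      by (simp add: max_def divide_simps split: if_splits)
    then show ?thesis
      using t by (simp add: sum_subtractf sum_unit_clamp right_diff_distrib)
  qed
  have "sv_function t' A = (\<Prod>i<?n. ?a i powr ?e t' i) * \<bar>det A\<bar> powr ?g t'"
    using A t by (simp add: sv_function_eq)
  also have "\<dots> \<le> (\<Prod>i<?n. ?a i powr ?e t i * c powr (?e t' i - ?e t i))
      * (\<bar>det A\<bar> powr ?g t * c powr (real ?n * (?g t' - ?g t)))"
    using 1 2 by (intro mult_mono prod_mono prod_nonneg) auto
  also have "\<dots> = sv_function t A * (c powr (\<Sum>i<?n. ?e t' i - ?e t i) * c powr (real ?n * (?g t' - ?g t)))"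
    using A t c0 by (simp add: sv_function_eq prod.distrib powr_sum)
  also have "\<dots> = sv_function t A * c powr (t' - t)"
    by (simp only: powr_add[symmetric] exps)
  finally show ?thesis .
qed

text \<open>Up to a constant, the number of cubes of side \<open>d\<close> needed to cover a box whose edges are the
  singular values of \<open>A\<close>.\<close>

definition semiaxis_count :: "real^'n^'n \<Rightarrow> real \<Rightarrow> real" where
  "semiaxis_count A d = (\<Prod>i<CARD('n). max (singular_values A ! i / d) 1)"

lemma semiaxis_count_pos: "0 < semiaxis_count A d"
  by (auto simp: semiaxis_count_def intro!: prod_pos)

text \<open>Factor by factor, \<open>\<alpha>\<^sup>e \<le> max(\<alpha>/d, 1) d\<^sup>e\<close> for \<open>0 \<le> e \<le> 1\<close>; the exponents add up to \<open>t\<close>.\<close>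

lemma sv_function_le_semiaxis_count:
  fixes A :: "real^'n^'n"
  assumes A: "invertible A" and t: "0 \<le> t" "t \<le> real CARD('n)" and d: "0 < d"
  shows "sv_function t A \<le> semiaxis_count A d * d powr t"
proof -
  let ?n = "CARD('n)" and ?a = "\<lambda>i. singular_values A ! i"
  let ?e = "\<lambda>i. unit_clamp (t - real i)"
  note pos = singular_values_pos[OF A]
  have det: "\<bar>det A\<bar> > 0" using A by (simp add: invertible_det_nz)
  have "?a i powr ?e i \<le> max (?a i / d) 1 * d powr ?e i" if "i < ?n" for i
  proof -
    have "?a i powr ?e i = (?a i / d) powr ?e i * d powr ?e i"
      using pos[OF that] d by (simp flip: powr_mult)
    also have "(?a i / d) powr ?e i \<le> max (?a i / d) 1 powr ?e i"
      using pos[OF that] d by (intro powr_mono2) (auto simp: unit_clamp_def)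
    also have "\<dots> \<le> max (?a i / d) 1 powr 1"
      by (intro powr_mono) (auto simp: unit_clamp_def)
    finally show ?thesis using d by simp
  qed
  then have "(\<Prod>i<?n. ?a i powr ?e i) \<le> (\<Prod>i<?n. max (?a i / d) 1 * d powr ?e i)"
    by (intro prod_mono) auto
  also have "\<dots> = semiaxis_count A d * d powr (\<Sum>i<?n. ?e i)"
    using d by (simp add: prod.distrib powr_sum semiaxis_count_def)
  also have "(\<Sum>i<?n. ?e i) = t" using t by (simp add: sum_unit_clamp)
  finally have "(\<Prod>i<?n. ?a i powr ?e i) \<le> semiaxis_count A d * d powr t" .
  moreover have "max 0 (t / real ?n - 1) = 0" using t by (simp add: divide_simps)
  ultimately show ?thesis using det by (simp add: sv_function_eq A t(1))
qed

text \<open>At \<open>d = \<alpha>\<^sub>m\<close> the previous estimate is an equality in every factor: the exponent is 1 where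
  \<open>\<alpha>\<^sub>i > d\<close> and 0 where \<open>\<alpha>\<^sub>i < d\<close>.\<close>

lemma sv_function_eq_semiaxis_count:
  fixes A :: "real^'n^'n"
  assumes A: "invertible A" and t: "0 < t" "t \<le> real CARD('n)"
  defines "d \<equiv> singular_values A ! (nat \<lceil>t\<rceil> - 1)"
  shows "sv_function t A = semiaxis_count A d * d powr t"
proof -
  let ?n = "CARD('n)" and ?a = "\<lambda>i. singular_values A ! i"
  let ?e = "\<lambda>i. unit_clamp (t - real i)"
  note pos = singular_values_pos[OF A]
  have det: "\<bar>det A\<bar> > 0" using A by (simp add: invertible_det_nz)
  define m where "m = nat \<lceil>t\<rceil> - 1"
  have m: "real m < t" "t \<le> real m + 1" "m < ?n"
    using t unfolding m_def by linarith+
  have d: "d = ?a m" "0 < d" using pos m by (auto simp: d_def m_def)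
  have "?a i powr ?e i = max (?a i / d) 1 * d powr ?e i" if i: "i < ?n" for i
  proof -
    consider "i < m" | "i = m" | "m < i" by linarith
    then show ?thesis
    proof cases
      case 1
      then have "?e i = 1" using m by (auto simp: unit_clamp_def)
      moreover have "d \<le> ?a i" using singular_values_antimono[of i m A] 1 m d by simp
      ultimately show ?thesis using d pos[OF i] by (simp add: max_def)
    next
      case 2
      then show ?thesis using d by simp
    next
      case 3
      then have "?e i = 0" using m by (auto simp: unit_clamp_def)
      moreover have "?a i \<le> d" using singular_values_antimono[of m i A] 3 i d by simp
      ultimately show ?thesis using d pos[OF i] by (simp add: max_def)
    qed
  qed
  then have "(\<Prod>i<?n. ?a i powr ?e i) = (\<Prod>i<?n. max (?a i / d) 1 * d powr ?e i)"
    by (intro prod.cong) auto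
  also have "\<dots> = semiaxis_count A d * d powr (\<Sum>i<?n. ?e i)"
    using d by (simp add: prod.distrib powr_sum semiaxis_count_def)
  also have "(\<Sum>i<?n. ?e i) = t" using t by (simp add: sum_unit_clamp)
  finally have "(\<Prod>i<?n. ?a i powr ?e i) = semiaxis_count A d * d powr t" .
  moreover have "max 0 (t / real ?n - 1) = 0" using t by (simp add: divide_simps)
  ultimately show ?thesis using det t by (simp add: sv_function_eq A)
qed

section \<open>Covering numbers\<close>

definition cube_cover :: "real \<Rightarrow> (real^'n) set set \<Rightarrow> (real^'n) set \<Rightarrow> bool" where
  "cube_cover d P E \<longleftrightarrow> finite P \<and> (\<forall>Q\<in>P. \<exists>a. Q = hypercube a d) \<and> E \<subseteq> \<Union>P"

lemma mem_hypercube: "x \<in> hypercube a d \<longleftrightarrow> (\<forall>i. a $ i \<le> x $ i \<and> x $ i \<le> a $ i + d)"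
  by (simp add: hypercube_def mem_box_cart)

lemma hypercube_norm_le:
  fixes x y :: "real^'n"
  assumes "x \<in> hypercube a d" "y \<in> hypercube a d"
  shows "norm (x - y) \<le> sqrt (real CARD('n)) * d"
proof -
  have le: "\<bar>(x - y) $ i\<bar> \<le> d" for i
  proof -
    have "a $ i \<le> x $ i" "x $ i \<le> a $ i + d" "a $ i \<le> y $ i" "y $ i \<le> a $ i + d"
      using assms by (simp_all add: mem_hypercube)
    then show ?thesis by (simp add: abs_le_iff)
  qed
  then have d: "0 \<le> d" by (rule order_trans[OF abs_ge_zero])
  have "(norm (x - y))\<^sup>2 = (\<Sum>i\<in>UNIV. ((x - y) $ i)\<^sup>2)"
    by (simp add: norm_vec_def L2_set_def sum_nonneg)
  also have "\<dots> \<le> (\<Sum>i\<in>(UNIV :: 'n set). d\<^sup>2)"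
    using le d by (intro sum_mono) (metis abs_le_square_iff abs_of_nonneg)
  also have "\<dots> = (sqrt (real CARD('n)) * d)\<^sup>2" by (simp add: power_mult_distrib)
  finally show ?thesis by (rule power2_le_imp_le) (simp add: d)
qed

lemma cball_subset_hypercube: "cball z \<rho> \<subseteq> hypercube (z - (\<chi> i. \<rho>)) (2 * \<rho>)"
proof
  fix x assume "x \<in> cball z \<rho>"
  then have "\<bar>(x - z) $ i\<bar> \<le> \<rho>" for i
    by (metis component_le_norm_cart dist_commute dist_norm mem_cball order_trans)
  then show "x \<in> hypercube (z - (\<chi> i. \<rho>)) (2 * \<rho>)"
    by (auto simp: mem_hypercube abs_le_iff algebra_simps dest: spec)
qed

lemma bounded_hypercube: "bounded (hypercube a d)"
  by (simp add: hypercube_def)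

lemma cube_cover_exists:
  fixes E :: "(real^'n) set"
  assumes "bounded E" "0 < d"
  shows "\<exists>P. cube_cover d P E"
proof -
  have "compact (closure E)" using assms(1) by (simp add: compact_closure)
  then obtain k where k: "finite k" "closure E \<subseteq> (\<Union>x\<in>k. ball x (d / 2))"
    using assms(2) unfolding compact_eq_totally_bounded by (meson half_gt_zero)
  let ?P = "(\<lambda>x. hypercube (x - (\<chi> i. d / 2)) d) ` k"
  have "E \<subseteq> \<Union> ?P"
  proof
    fix y assume "y \<in> E"
    then obtain x where x: "x \<in> k" "y \<in> ball x (d / 2)" using k(2) closure_subset by blast
    then have "y \<in> hypercube (x - (\<chi> i. d / 2)) (2 * (d / 2))"
      using cball_subset_hypercube ball_subset_cball by blast
    then show "y \<in> \<Union> ?P" using x(1) by auto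
  qed
  then have "cube_cover d ?P E" using k(1) by (auto simp: cube_cover_def)
  then show ?thesis by blast
qed

lemma covering_number_alt:
  "covering_number d E = (LEAST m. \<exists>P. cube_cover d P E \<and> card P = m)"
  unfolding covering_number_def cube_cover_def by (intro arg_cong[of _ _ Least] ext) blast

lemma covering_number_le: "cube_cover d P E \<Longrightarrow> covering_number d E \<le> card P"
  unfolding covering_number_alt by (rule Least_le) blast

text \<open>A bounded set has a finite cover, so the minimum that defines its covering number is attained.\<close>

lemma covering_number_attained:
  fixes E :: "(real^'n) set"
  assumes "bounded E" "0 < d"
  obtains P where "cube_cover d P E" "card P = covering_number d E"
proof -
  have "\<exists>m. \<exists>P. cube_cover d P E \<and> card P = m" using cube_cover_exists[OF assms] by blast
  from LeastI_ex[OF this] show thesis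
    unfolding covering_number_alt[symmetric] using that by blast
qed

lemma covering_number_mono:
  fixes E :: "(real^'n) set"
  assumes "E \<subseteq> F" "bounded F" "0 < d"
  shows "covering_number d E \<le> covering_number d F"
proof -
  obtain P where P: "cube_cover d P F" "card P = covering_number d F"
    using covering_number_attained assms(2,3) by blast
  then have "cube_cover d P E" using assms(1) by (auto simp: cube_cover_def)
  then show ?thesis using covering_number_le P(2) by metis
qed

lemma covering_number_pos:
  fixes E :: "(real^'n) set"
  assumes "bounded E" "E \<noteq> {}" "0 < d"
  shows "1 \<le> covering_number d E"
proof -
  obtain P where P: "cube_cover d P E" "card P = covering_number d E"
    using covering_number_attained assms by blast
  then have "P \<noteq> {}" "finite P" using assms(2) by (auto simp: cube_cover_def)
  then show ?thesis using P(2) by (metis One_nat_def Suc_leI card_gt_0_iff)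
qed

lemma covering_number_Union_le:
  fixes E :: "'i \<Rightarrow> (real^'n) set"
  assumes I: "finite I" and bdd: "\<And>i. i \<in> I \<Longrightarrow> bounded (E i)" and d: "0 < d"
  shows "covering_number d (\<Union>i\<in>I. E i) \<le> (\<Sum>i\<in>I. covering_number d (E i))"
proof -
  have "\<forall>i\<in>I. \<exists>P. cube_cover d P (E i) \<and> card P = covering_number d (E i)"
    using covering_number_attained[OF bdd d] by metis
  then obtain P where P: "\<And>i. i \<in> I \<Longrightarrow> cube_cover d (P i) (E i)"
      "\<And>i. i \<in> I \<Longrightarrow> card (P i) = covering_number d (E i)"
    by metis
  have "cube_cover d (\<Union>i\<in>I. P i) (\<Union>i\<in>I. E i)"
    using P(1) I by (fastforce simp: cube_cover_def)
  then have "covering_number d (\<Union>i\<in>I. E i) \<le> card (\<Union>i\<in>I. P i)" by (rule covering_number_le)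
  also have "\<dots> \<le> (\<Sum>i\<in>I. card (P i))" using I by (rule card_UN_le)
  finally show ?thesis using P(2) by simp
qed

lemma covering_number_Un_le:
  fixes E F :: "(real^'n) set"
  assumes "bounded E" "bounded F" "0 < d"
  shows "covering_number d (E \<union> F) \<le> covering_number d E + covering_number d F"
proof -
  have "bounded (if b then E else F)" for b using assms by simp
  then have "covering_number d (\<Union>b. if b then E else F) \<le> (\<Sum>b\<in>UNIV. covering_number d (if b then E else F))"
    using assms(3) by (intro covering_number_Union_le) simp_all
  then show ?thesis by (simp add: UNIV_bool Un_commute)
qed

lemma covering_number_antimono:
  fixes E :: "(real^'n) set"
  assumes "bounded E" "0 < d" "d \<le> d'"
  shows "covering_number d' E \<le> covering_number d E"
proof -
  obtain P where P: "cube_cover d P E" "card P = covering_number d E"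
    using covering_number_attained assms by blast
  have "\<forall>Q\<in>P. \<exists>a. Q = hypercube a d" using P(1) by (simp add: cube_cover_def)
  then obtain a where a: "\<And>Q. Q \<in> P \<Longrightarrow> Q = hypercube (a Q) d" by metis
  let ?P = "(\<lambda>Q. hypercube (a Q) d') ` P"
  have "hypercube b d \<subseteq> hypercube b d'" for b :: "real^'n"
    using assms(3) unfolding mem_hypercube subset_iff by (meson add_left_mono order_trans)
  then have "Q \<subseteq> hypercube (a Q) d'" if "Q \<in> P" for Q
    using a[OF that] by metis
  then have "\<Union>P \<subseteq> \<Union>?P" by blast
  then have "cube_cover d' ?P E" using P(1) by (auto simp: cube_cover_def)
  then have "covering_number d' E \<le> card ?P" by (rule covering_number_le)
  also have "\<dots> \<le> card P" using P(1) by (intro card_image_le) (simp add: cube_cover_def)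
  finally show ?thesis using P(2) by simp
qed

lemma covering_number_hypercube_le: "covering_number d (hypercube a d) \<le> 1"
  using covering_number_le[of d "{hypercube a d}" "hypercube a d"] by (auto simp: cube_cover_def)

text \<open>Two points at distance more than \<open>\<surd>n d\<close>, the diameter of a cube of side \<open>d\<close>, lie in different
  cubes of a cover.\<close>

lemma separated_card_le_covering_number:
  fixes E X :: "(real^'n) set"
  assumes E: "bounded E" "0 < d" and X: "X \<subseteq> E" "finite X"
    and sep: "\<And>x y. \<lbrakk>x \<in> X; y \<in> X; x \<noteq> y\<rbrakk> \<Longrightarrow> sqrt (real CARD('n)) * d < norm (x - y)"
  shows "card X \<le> covering_number d E"
proof -
  obtain P where P: "cube_cover d P E" "card P = covering_number d E"
    using covering_number_attained E by blast
  have "\<forall>x\<in>X. \<exists>Q\<in>P. x \<in> Q" using P(1) X(1) by (auto simp: cube_cover_def)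
  then obtain q where q: "\<And>x. x \<in> X \<Longrightarrow> q x \<in> P \<and> x \<in> q x" by metis
  have "inj_on q X"
  proof (rule inj_onI, rule ccontr)
    fix x y assume xy: "x \<in> X" "y \<in> X" "q x = q y" "x \<noteq> y"
    obtain a where "q x = hypercube a d" using q[OF xy(1)] P(1) by (auto simp: cube_cover_def)
    then have "norm (x - y) \<le> sqrt (real CARD('n)) * d"
      using q[OF xy(1)] q[OF xy(2)] xy(3) by (intro hypercube_norm_le[of _ a]) auto
    then show False using sep[OF xy(1,2,4)] by simp
  qed
  moreover have "q ` X \<subseteq> P" using q by blast
  ultimately have "card X \<le> card P"
    using P(1) by (intro card_inj_on_le) (auto simp: cube_cover_def)
  then show ?thesis using P(2) by simp
qed

lemma matrix_image_in_frame:
  fixes A :: "real^'n^'n"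
  assumes Au: "\<And>i. i < CARD('n) \<Longrightarrow> A *v u i = (singular_values A ! i) *\<^sub>R v i"
  shows "A *v (\<Sum>i<CARD('n). c i *\<^sub>R u i) = (\<Sum>i<CARD('n). (c i * singular_values A ! i) *\<^sub>R v i)"
proof -
  have "A *v (\<Sum>i<CARD('n). c i *\<^sub>R u i) = (\<Sum>i<CARD('n). A *v (c i *\<^sub>R u i))"
    using linear_sum[of "(*v) A" "\<lambda>i. c i *\<^sub>R u i" "{..<CARD('n)}"] by simp
  also have "\<dots> = (\<Sum>i<CARD('n). (c i * singular_values A ! i) *\<^sub>R v i)"
    using Au by (intro sum.cong) (auto simp: matrix_vector_mult_scaleR)
  finally show ?thesis .
qed

section \<open>Covering numbers of affine images and submultiplicativity\<close>

text \<open>The image of a cube of side \<open>r\<close> lies in a box with edges of order \<open>\<alpha>\<^sub>i r\<close> along an orthonormal frame.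
  A grid of mesh \<open>d/(2\<surd>n)\<close> along the frame has at most a constant times \<open>max(\<alpha>\<^sub>i r/d, 1)\<close> layers in
  direction \<open>i\<close>, and every point of the box is within \<open>d/2\<close> of a grid point, hence in the cube of
  side \<open>d\<close> centred there.\<close>

lemma covering_number_affine_image_le:
  fixes A :: "real^'n^'n"
  assumes A: "invertible A" and E: "bounded E" and r: "0 < r" and d: "0 < d"
  shows "real (covering_number d ((\<lambda>x. A *v x + b) ` E))
     \<le> (4 * real CARD('n) + 2) ^ CARD('n) * semiaxis_count A (d / r) * real (covering_number r E)"
proof -
  let ?n = "CARD('n)" and ?a = "\<lambda>i. singular_values A ! i"
  define w where "w = sqrt (real ?n)"
  have w: "0 < w" "w * w = real ?n" by (simp_all add: w_def)
  note pos = singular_values_pos[OF A]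
  obtain u v where u: "orthonormal_frame u" and v: "orthonormal_frame v"
    and Au: "\<And>i. i < ?n \<Longrightarrow> A *v u i = ?a i *\<^sub>R v i"
    using singular_value_decomposition[OF A] by metis
  define h where "h = d / (2 * w)"
  have h: "0 < h" using d w by (simp add: h_def)
  \<comment> \<open>Half the extent of the box in direction \<open>i\<close>, in units of the mesh \<open>h\<close>.\<close>
  define M where "M = (\<lambda>i. 2 * real ?n * ?a i * r / d)"
  define G where "G = (\<Pi>\<^sub>E i\<in>{..<?n}. {\<lfloor>- M i\<rfloor>..\<lfloor>M i\<rfloor>})"
  have finG: "finite G" unfolding G_def by (intro finite_PiE) auto
  have M0: "0 < M i" if "i < ?n" for i using pos[OF that] r d by (simp add: M_def)
  have "real (card G) = (\<Prod>i<?n. real (card {\<lfloor>- M i\<rfloor>..\<lfloor>M i\<rfloor>}))"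
    unfolding G_def by (subst card_PiE) auto
  also have "\<dots> \<le> (\<Prod>i<?n. (4 * real ?n + 2) * max (?a i / (d / r)) 1)"
  proof (intro prod_mono conjI)
    fix i assume "i \<in> {..<?n}"
    then have i: "i < ?n" by simp
    have "real (card {\<lfloor>- M i\<rfloor>..\<lfloor>M i\<rfloor>}) = of_int (\<lfloor>M i\<rfloor> - \<lfloor>- M i\<rfloor> + 1)"
      using M0[OF i] by simp linarith
    also have "\<dots> \<le> 2 * M i + 2" by linarith
    also have "\<dots> = 4 * real ?n * (?a i / (d / r)) + 2" by (simp add: M_def)
    also have "\<dots> \<le> 4 * real ?n * max (?a i / (d / r)) 1 + 2 * max (?a i / (d / r)) 1"
      by (intro add_mono mult_left_mono) auto
    finally show "real (card {\<lfloor>- M i\<rfloor>..\<lfloor>M i\<rfloor>}) \<le> (4 * real ?n + 2) * max (?a i / (d / r)) 1"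
      by (simp add: algebra_simps)
  qed simp
  also have "\<dots> = (4 * real ?n + 2) ^ ?n * semiaxis_count A (d / r)"
    by (simp add: prod.distrib semiaxis_count_def)
  finally have cardG: "real (card G) \<le> (4 * real ?n + 2) ^ ?n * semiaxis_count A (d / r)" .
  define q where "q = (\<lambda>p k. hypercube (A *v p + b + (\<Sum>i<?n. (h * real_of_int (k i)) *\<^sub>R v i) - (\<chi> i. d / 2)) d)"
  have cover: "\<exists>k\<in>G. A *v x + b \<in> q p k" if x: "x \<in> hypercube p r" for x p
  proof -
    define c where "c = (\<lambda>i. ((x - p) \<bullet> u i) * ?a i)"
    have p: "p \<in> hypercube p r" using r by (simp add: mem_hypercube)
    have c: "\<bar>c i / h\<bar> \<le> M i" if i: "i < ?n" for i
    proof -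
      have "norm (u i) = 1" using u i by (simp add: orthonormal_frame_def norm_eq_1)
      then have "\<bar>(x - p) \<bullet> u i\<bar> \<le> w * r"
        using Cauchy_Schwarz_ineq2[of "x - p" "u i"] hypercube_norm_le[OF x p] by (simp add: w_def)
      then have "\<bar>c i\<bar> \<le> (w * r) * ?a i"
        using pos[OF i] by (simp add: c_def abs_mult)
      then have "\<bar>c i\<bar> / h \<le> (w * r) * ?a i / h" using h by (intro divide_right_mono) auto
      also have "\<dots> = 2 * (w * w) * ?a i * r / d" unfolding h_def using w(1) d by (simp add: field_simps)
      finally show ?thesis using h by (simp add: M_def w(2))
    qed
    define k where "k = restrict (\<lambda>i. \<lfloor>c i / h\<rfloor>) {..<?n}"
    have "k \<in> G" unfolding G_def k_def
    proof (rule restrict_PiE_iff[THEN iffD2], intro ballI)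
      fix i assume "i \<in> {..<?n}"
      then have "\<bar>c i / h\<bar> \<le> M i" using c by simp
      then have "- M i \<le> c i / h" "c i / h \<le> M i" by linarith+
      then show "\<lfloor>c i / h\<rfloor> \<in> {\<lfloor>- M i\<rfloor>..\<lfloor>M i\<rfloor>}" by (simp add: floor_mono)
    qed
    moreover have "A *v x + b \<in> q p k"
    proof -
      have "A *v (x - p) = A *v (\<Sum>i<?n. ((x - p) \<bullet> u i) *\<^sub>R u i)"
        using orthonormal_frame_expand[OF u, of "x - p"] by simp
      also have "\<dots> = (\<Sum>i<?n. c i *\<^sub>R v i)"
        unfolding c_def by (rule matrix_image_in_frame[OF Au])
      finally have Ax: "A *v x = A *v p + (\<Sum>i<?n. c i *\<^sub>R v i)"
        by (simp add: matrix_vector_mult_diff_distrib algebra_simps)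
      let ?z = "A *v p + b + (\<Sum>i<?n. (h * real_of_int (k i)) *\<^sub>R v i)"
      have "A *v x + b - ?z = (\<Sum>i<?n. (c i - h * real_of_int (k i)) *\<^sub>R v i)"
        by (simp add: Ax sum_subtractf scaleR_diff_left)
      then have "(norm (A *v x + b - ?z))\<^sup>2 = (\<Sum>i<?n. (c i - h * real_of_int (k i))\<^sup>2)"
        using orthonormal_frame_norm_sum[OF v] by simp
      also have "\<dots> \<le> (\<Sum>i<?n. h\<^sup>2)"
      proof (intro sum_mono)
        fix i assume "i \<in> {..<?n}"
        then have "k i = \<lfloor>c i / h\<rfloor>" by (simp add: k_def)
        then have "real_of_int (k i) \<le> c i / h" "c i / h \<le> real_of_int (k i) + 1" by linarith+
        then have "h * real_of_int (k i) \<le> c i" "c i \<le> h * real_of_int (k i) + h"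
          using h by (simp_all add: field_simps)
        then show "(c i - h * real_of_int (k i))\<^sup>2 \<le> h\<^sup>2" using h by (intro power_mono) auto
      qed
      also have "\<dots> = (d / 2)\<^sup>2"
        using w by (simp add: h_def power2_eq_square)
      finally have "norm (A *v x + b - ?z) \<le> d / 2"
        by (rule power2_le_imp_le) (use d in simp)
      then have "A *v x + b \<in> cball ?z (d / 2)" 
        by (subst mem_cball, subst dist_commute, simp only: dist_norm)
      then show ?thesis
        using cball_subset_hypercube[of ?z "d / 2"] by (auto simp: q_def)
    qed
    ultimately show ?thesis by blast
  qed
  obtain P where P: "cube_cover r P E" "card P = covering_number r E"
    using covering_number_attained[OF E r] by blast
  have finP: "finite P" using P(1) by (simp add: cube_cover_def)
  have "\<forall>Q\<in>P. \<exists>a. Q = hypercube a r" using P(1) by (simp add: cube_cover_def)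
  then obtain p where p: "\<And>Q. Q \<in> P \<Longrightarrow> Q = hypercube (p Q) r" by metis
  let ?R = "(\<lambda>(Q, k). q (p Q) k) ` (P \<times> G)"
  have "cube_cover d ?R ((\<lambda>x. A *v x + b) ` E)"
    unfolding cube_cover_def
  proof (intro conjI ballI)
    show "finite ?R" using finP finG by simp
    show "\<exists>a. Q = hypercube a d" if "Q \<in> ?R" for Q using that by (auto simp: q_def)
    show "(\<lambda>x. A *v x + b) ` E \<subseteq> \<Union> ?R"
    proof (rule image_subsetI)
      fix x assume "x \<in> E"
      then obtain Q where Q: "Q \<in> P" "x \<in> Q" using P(1) by (auto simp: cube_cover_def)
      then have "x \<in> hypercube (p Q) r" using p[OF Q(1)] by simp
      then obtain k where "k \<in> G" "A *v x + b \<in> q (p Q) k" using cover by blast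
      then show "A *v x + b \<in> \<Union> ?R" using Q(1) by force
    qed
  qed
  then have "covering_number d ((\<lambda>x. A *v x + b) ` E) \<le> card ?R" by (rule covering_number_le)
  also have "\<dots> \<le> card (P \<times> G)" using finP finG by (intro card_image_le) simp
  finally have "real (covering_number d ((\<lambda>x. A *v x + b) ` E)) \<le> real (card G) * real (covering_number r E)"
    by (simp add: card_cartesian_product P(2) mult.commute flip: of_nat_mult)
  also have "\<dots> \<le> (4 * real ?n + 2) ^ ?n * semiaxis_count A (d / r) * real (covering_number r E)"
    using cardG by (intro mult_right_mono) auto
  finally show ?thesis .
qed

text \<open>The converse estimate for the unit cube.  It contains a ball of radius 1/2, whose image contains a
  grid along the frame, of mesh \<open>2\<surd>n d\<close>; no two grid points lie in a common cube of side \<open>d\<close>.\<close>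

lemma semiaxis_count_le_covering_number:
  fixes A :: "real^'n^'n"
  assumes A: "invertible A" and d: "0 < d"
  shows "semiaxis_count A d
     \<le> (4 * real CARD('n)) ^ CARD('n) * real (covering_number d ((\<lambda>x. A *v x) ` hypercube 0 1))"
proof -
  let ?n = "CARD('n)" and ?a = "\<lambda>i. singular_values A ! i"
  define w where "w = sqrt (real ?n)"
  have w: "0 < w" "w * w = real ?n" by (simp_all add: w_def)
  note pos = singular_values_pos[OF A]
  obtain u v where u: "orthonormal_frame u" and v: "orthonormal_frame v"
    and Au: "\<And>i. i < ?n \<Longrightarrow> A *v u i = ?a i *\<^sub>R v i"
    using singular_value_decomposition[OF A] by metis
  define h where "h = 2 * w * d"
  have h: "0 < h" using d w by (simp add: h_def)
  \<comment> \<open>A displacement by \<open>M i\<close> steps of the mesh \<open>h\<close> has a preimage of length \<open>h M\<^sub>i / \<alpha>\<^sub>i = 1/(2\<surd>n)\<close>, and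
  \<open>n\<close> orthogonal vectors of this length add up to a vector of length 1/2.\<close>
  define M where "M = (\<lambda>i. ?a i / (4 * real ?n * d))"
  have M0: "0 < M i" if "i < ?n" for i using pos[OF that] d by (simp add: M_def)
  define G where "G = (\<Pi>\<^sub>E i\<in>{..<?n}. {..nat \<lfloor>M i\<rfloor>})"
  have finG: "finite G" unfolding G_def by (intro finite_PiE) auto
  define z :: "real^'n" where "z = (\<chi> i. 1 / 2)"
  define y where "y = (\<lambda>k. A *v z + (\<Sum>i<?n. (h * real (k i)) *\<^sub>R v i))"
  have sep: "w * d < norm (y k - y l)" if kl: "k \<in> G" "l \<in> G" "k \<noteq> l" for k l
  proof -
    obtain j where j: "j < ?n" "k j \<noteq> l j"
      using kl PiE_ext[of k "{..<?n}" _ l] unfolding G_def by (metis lessThan_iff)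
    have "y k - y l = (\<Sum>i<?n. (h * (real (k i) - real (l i))) *\<^sub>R v i)"
      by (simp add: y_def sum_subtractf right_diff_distrib scaleR_diff_left)
    then have "(norm (y k - y l))\<^sup>2 = (\<Sum>i<?n. (h * (real (k i) - real (l i)))\<^sup>2)"
      using orthonormal_frame_norm_sum[OF v] by simp
    also have "\<dots> \<ge> (h * (real (k j) - real (l j)))\<^sup>2"
      using j(1) by (intro member_le_sum) auto
    also have "(h * (real (k j) - real (l j)))\<^sup>2 \<ge> h\<^sup>2 * 1"
    proof -
      have "1 \<le> \<bar>real (k j) - real (l j)\<bar>" using j(2) by linarith
      then have "1\<^sup>2 \<le> (real (k j) - real (l j))\<^sup>2" using power_mono[of 1 "\<bar>real (k j) - real (l j)\<bar>" 2] by simp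
      then show ?thesis unfolding power_mult_distrib by (intro mult_left_mono) auto
    qed
    finally have "h \<le> norm (y k - y l)" by (intro power2_le_imp_le[of h]) simp_all
    moreover have "w * d < h" using w d by (simp add: h_def)
    ultimately show ?thesis by simp
  qed
  have inj: "inj_on y G"
  proof (rule inj_onI, rule ccontr)
    fix k l assume "k \<in> G" "l \<in> G" "y k = y l" "k \<noteq> l"
    then have "w * d < 0" using sep[of k l] by simp
    then show False using mult_pos_pos[OF w(1) d] by simp
  qed
  have sub: "y ` G \<subseteq> (\<lambda>x. A *v x) ` hypercube 0 1"
  proof (rule image_subsetI)
    fix k assume k: "k \<in> G"
    let ?c = "\<lambda>i. h * real (k i) / ?a i"
    let ?x = "\<Sum>i<?n. ?c i *\<^sub>R u i"
    have "(norm ?x)\<^sup>2 = (\<Sum>i<?n. (?c i)\<^sup>2)" by (rule orthonormal_frame_norm_sum[OF u])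
    also have "\<dots> \<le> (\<Sum>i<?n. (1 / (2 * w))\<^sup>2)"
    proof (intro sum_mono)
      fix i assume "i \<in> {..<?n}"
      then have i: "i < ?n" by simp
      have "k i \<le> nat \<lfloor>M i\<rfloor>" using k i by (auto simp: G_def PiE_iff)
      then have "real (k i) \<le> M i" using M0[OF i] by linarith
      then have "?c i \<le> h * M i / ?a i" using h pos[OF i] by (intro divide_right_mono mult_left_mono) auto
      also have "\<dots> = w / (2 * (w * w))" using pos[OF i] d by (simp add: h_def M_def w(2))
      also have "\<dots> = 1 / (2 * w)" using w(1) by simp
      finally show "(?c i)\<^sup>2 \<le> (1 / (2 * w))\<^sup>2" using h pos[OF i] by (intro power_mono) auto
    qed
    also have "\<dots> = (1 / 2)\<^sup>2" using w by (simp add: power2_eq_square field_simps)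
    finally have "norm ?x \<le> 1 / 2" by (rule power2_le_imp_le) simp
    then have "z + ?x \<in> cball z (1 / 2)" by (simp add: dist_norm)
    then have mem: "z + ?x \<in> hypercube 0 1"
      using cball_subset_hypercube[of z "1 / 2"] by (auto simp: z_def zero_vec_def[symmetric])
    have "A *v (z + ?x) = y k"
    proof -
      have "A *v ?x = (\<Sum>i<?n. (?c i * ?a i) *\<^sub>R v i)" by (rule matrix_image_in_frame[OF Au])
      also have "\<dots> = (\<Sum>i<?n. (h * real (k i)) *\<^sub>R v i)"
        using singular_values_nonzero[OF A] by (intro sum.cong) auto
      finally show ?thesis by (simp add: y_def matrix_vector_right_distrib)
    qed
    then show "y k \<in> (\<lambda>x. A *v x) ` hypercube 0 1" by (intro image_eqI[OF _ mem]) (rule sym)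
  qed
  have bdd: "bounded ((\<lambda>x. A *v x) ` hypercube 0 1)"
    by (intro bounded_linear_image bounded_hypercube) (simp add: linear_conv_bounded_linear[symmetric])
  have "semiaxis_count A d \<le> (\<Prod>i<?n. 4 * real ?n * real (card {..nat \<lfloor>M i\<rfloor>}))"
    unfolding semiaxis_count_def
  proof (intro prod_mono conjI)
    fix i assume "i \<in> {..<?n}"
    then have i: "i < ?n" by simp
    have "M i \<le> real (nat \<lfloor>M i\<rfloor>) + 1" using M0[OF i] by linarith
    then have "4 * real ?n * M i \<le> 4 * real ?n * (real (nat \<lfloor>M i\<rfloor>) + 1)" by (intro mult_left_mono) auto
    moreover have "4 * real ?n * M i = ?a i / d" by (simp add: M_def)
    moreover have "1 * 1 \<le> 4 * real ?n * (real (nat \<lfloor>M i\<rfloor>) + 1)"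
    proof (rule mult_mono)
      have "1 \<le> real ?n" by (simp add: Suc_leI)
      then show "1 \<le> 4 * real ?n" by linarith
    qed simp_all
    ultimately show "max (?a i / d) 1 \<le> 4 * real ?n * real (card {..nat \<lfloor>M i\<rfloor>})"
      by (simp add: algebra_simps)
  qed simp
  also have "\<dots> = (4 * real ?n) ^ ?n * real (card G)"
    unfolding G_def by (subst card_PiE) (simp_all add: prod.distrib)
  finally have "semiaxis_count A d \<le> (4 * real ?n) ^ ?n * real (card G)" .
  moreover have "real (card G) \<le> real (covering_number d ((\<lambda>x. A *v x) ` hypercube 0 1))"
    unfolding card_image[OF inj, symmetric]
    using sep finG by (intro of_nat_mono separated_card_le_covering_number bdd d sub) (auto simp: w_def)
  ultimately show ?thesis by (rule order_trans[OF _ mult_left_mono]) simp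
qed

text \<open>One lower estimate of a covering number and two upper ones enter the product inequality.\<close>

definition product_const :: "'n itself \<Rightarrow> real" where
  "product_const TYPE('n) = (4 * real CARD('n)) ^ CARD('n) * ((4 * real CARD('n) + 2) ^ CARD('n))\<^sup>2"

lemma product_const_ge_1: "1 \<le> product_const TYPE('n::finite)"
proof -
  have "1 \<le> real CARD('n)" by (simp add: Suc_leI)
  then have 1: "1 \<le> (4 * real CARD('n)) ^ CARD('n)" by (intro one_le_power) linarith
  have 2: "1 \<le> ((4 * real CARD('n) + 2) ^ CARD('n))\<^sup>2" by (intro one_le_power) simp
  have "1 * 1 \<le> (4 * real CARD('n)) ^ CARD('n) * ((4 * real CARD('n) + 2) ^ CARD('n))\<^sup>2"
    by (rule mult_mono[OF 1 2]) simp_all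
  then show ?thesis by (simp add: product_const_def)
qed

text \<open>Cover the image of the unit cube under \<open>B\<close> by cubes of side \<open>b\<close>, and the image of each of these
  under \<open>A\<close> by cubes of side \<open>ab\<close>.\<close>

lemma semiaxis_count_mult_le:
  fixes A B :: "real^'n^'n"
  assumes A: "invertible A" and B: "invertible B" and a: "0 < a" and b: "0 < b"
  shows "semiaxis_count (A ** B) (a * b) \<le> product_const TYPE('n) * (semiaxis_count A a * semiaxis_count B b)"
proof -
  let ?Q = "hypercube 0 1 :: (real^'n) set" and ?K = "(4 * real CARD('n) + 2) ^ CARD('n)"
    and ?k = "(4 * real CARD('n)) ^ CARD('n)"
  have bdd: "bounded ((\<lambda>x. B *v x) ` ?Q)"
    by (intro bounded_linear_image bounded_hypercube) (simp add: linear_conv_bounded_linear[symmetric])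
  have AB: "invertible (A ** B)" using A B by (simp add: invertible_mult)
  let ?NAB = "real (covering_number (a * b) ((\<lambda>x. (A ** B) *v x) ` ?Q))"
    and ?NB = "real (covering_number b ((\<lambda>x. B *v x) ` ?Q))"
  have 1: "semiaxis_count (A ** B) (a * b) \<le> ?k * ?NAB"
    using a b by (intro semiaxis_count_le_covering_number AB) simp
  have "(\<lambda>x. (A ** B) *v x) ` ?Q = (\<lambda>x. A *v x + 0) ` ((\<lambda>x. B *v x) ` ?Q)"
    by (simp add: image_image matrix_vector_mul_assoc)
  then have 2: "?NAB \<le> ?K * semiaxis_count A a * ?NB"
    using covering_number_affine_image_le[OF A bdd b, of "a * b" 0] a b by simp
  have "real (covering_number b ((\<lambda>x. B *v x + 0) ` ?Q))
      \<le> ?K * semiaxis_count B (b / 1) * real (covering_number 1 ?Q)"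
    by (rule covering_number_affine_image_le[OF B bounded_hypercube _ b]) simp
  also have "\<dots> \<le> ?K * semiaxis_count B (b / 1) * 1"
    using covering_number_hypercube_le[of 1 "0 :: real^'n"]
    by (intro mult_left_mono mult_nonneg_nonneg less_imp_le[OF semiaxis_count_pos]) auto
  finally have 3: "?NB \<le> ?K * semiaxis_count B b" by simp
  have "?k * ?NAB \<le> ?k * (?K * semiaxis_count A a * (?K * semiaxis_count B b))"
    using less_imp_le[OF semiaxis_count_pos[of A a]]
    by (intro mult_left_mono order_trans[OF 2 mult_left_mono[OF 3]]) simp_all
  also have "\<dots> = product_const TYPE('n) * (semiaxis_count A a * semiaxis_count B b)"
    by (simp add: product_const_def power2_eq_square mult_ac)
  finally show ?thesis using 1 by simp
qed

text \<open>For \<open>t \<le> n\<close>, evaluate the product inequality for \<open>semiaxis_count\<close> at the scales \<open>a\<close> and \<open>b\<close> where the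
  minima for \<open>A\<close> and \<open>B\<close> are attained.  For \<open>t > n\<close>, the function is a power of the determinant.\<close>

lemma sv_function_mult_le:
  fixes A B :: "real^'n^'n"
  assumes A: "invertible A" and B: "invertible B" and t: "0 \<le> t"
  shows "sv_function t (A ** B) \<le> product_const TYPE('n) * (sv_function t A * sv_function t B)"
proof -
  have AB: "invertible (A ** B)" using A B by (simp add: invertible_mult)
  consider "t = 0" | "0 < t" "t \<le> real CARD('n)" | "real CARD('n) < t" using t by linarith
  then show ?thesis
  proof cases
    case 1
    then show ?thesis using product_const_ge_1[where 'n='n] by simp
  next
    case 2
    define a b where "a = singular_values A ! (nat \<lceil>t\<rceil> - 1)" and "b = singular_values B ! (nat \<lceil>t\<rceil> - 1)"
    have "nat \<lceil>t\<rceil> - 1 < CARD('n)" using 2 by linarith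
    then have ab: "0 < a" "0 < b" using A B by (simp_all add: a_def b_def singular_values_pos)
    have "sv_function t (A ** B) \<le> semiaxis_count (A ** B) (a * b) * (a * b) powr t"
      using 2 ab by (intro sv_function_le_semiaxis_count AB) auto
    also have "\<dots> \<le> (product_const TYPE('n) * (semiaxis_count A a * semiaxis_count B b)) * (a * b) powr t"
      using ab by (intro mult_right_mono semiaxis_count_mult_le A B) auto
    also have "\<dots> = product_const TYPE('n) * ((semiaxis_count A a * a powr t) * (semiaxis_count B b * b powr t))"
      using ab by (simp add: powr_mult)
    also have "semiaxis_count A a * a powr t = sv_function t A"
      unfolding a_def by (rule sv_function_eq_semiaxis_count[OF A 2, symmetric])
    also have "semiaxis_count B b * b powr t = sv_function t B"
      unfolding b_def by (rule sv_function_eq_semiaxis_count[OF B 2, symmetric])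
    finally show ?thesis .
  next
    case 3
    then have "sv_function t (A ** B) = 1 * (sv_function t A * sv_function t B)"
      by (simp add: sv_function_def det_mul abs_mult powr_mult)
    also have "\<dots> \<le> product_const TYPE('n) * (sv_function t A * sv_function t B)"
      using sv_function_pos[OF A t] sv_function_pos[OF B t] product_const_ge_1
      by (intro mult_right_mono) auto
    finally show ?thesis .
  qed
qed

section \<open>Words and the affinity dimension\<close>

text \<open>An affine IFS with its linear parts, translations and a common contraction ratio made explicit.\<close>

locale contracting_affine_ifs =
  fixes N :: nat and S :: "nat \<Rightarrow> real^'n \<Rightarrow> real^'n" and A :: "nat \<Rightarrow> real^'n^'n"
    and b :: "nat \<Rightarrow> real^'n" and c :: real
  assumes N_ge_1: "1 \<le> N" and c_pos: "0 < c" and c_less_1: "c < 1"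
    and invertible_A: "i \<in> {1..N} \<Longrightarrow> invertible (A i)"
    and S_eq: "i \<in> {1..N} \<Longrightarrow> S i x = A i *v x + b i"
    and norm_A_le: "i \<in> {1..N} \<Longrightarrow> norm (A i *v x) \<le> c * norm x"

lemma affine_ifs_contracting:
  fixes S :: "nat \<Rightarrow> real^'n \<Rightarrow> real^'n"
  assumes "affine_ifs N S"
  obtains A b c where "contracting_affine_ifs N S A b c"
proof -
  have "\<forall>i\<in>{1..N}. \<exists>A b. invertible A \<and> (\<forall>x. S i x = A *v x + b)"
    using assms by (simp add: affine_ifs_def)
  then obtain A b where Ab: "\<And>i. i \<in> {1..N} \<Longrightarrow> invertible (A i) \<and> (\<forall>x. S i x = A i *v x + b i)"
    by metis
  have "\<forall>i\<in>{1..N}. \<exists>c. 0 < c \<and> c < 1 \<and> (\<forall>x y. norm (S i x - S i y) \<le> c * norm (x - y))"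
    using assms by (simp add: affine_ifs_def)
  then obtain c where c: "\<And>i. i \<in> {1..N} \<Longrightarrow> 0 < c i \<and> c i < 1 \<and> (\<forall>x y. norm (S i x - S i y) \<le> c i * norm (x - y))"
    by metis
  define C where "C = Max (c ` {1..N})"
  have N: "1 \<le> N" using assms by (simp add: affine_ifs_def)
  have "C \<in> c ` {1..N}" unfolding C_def using N by (intro Max_in) auto
  then have C: "0 < C" "C < 1" using c by auto
  have "norm (A i *v x) \<le> C * norm x" if i: "i \<in> {1..N}" for i x
  proof -
    have "norm (A i *v x) = norm (S i x - S i 0)" using Ab[OF i] by simp
    also have "\<dots> \<le> c i * norm (x - 0)" using c[OF i] by blast
    also have "\<dots> \<le> C * norm x"
      unfolding C_def using i by (simp add: mult_right_mono)
    finally show ?thesis .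
  qed
  then have "contracting_affine_ifs N S A b C"
    using N C Ab by unfold_locales auto
  then show thesis by (rule that)
qed

lemma word_map_Nil [simp]: "word_map S [] = id"
  and word_map_Cons [simp]: "word_map S (i # w) = S i \<circ> word_map S w"
  by (simp_all add: word_map_def)

lemma word_map_append: "word_map S (v @ w) = word_map S v \<circ> word_map S w"
  by (induction v) (simp_all add: comp_assoc)

lemma words_0 [simp]: "words N 0 = {[]}"
  by (auto simp: words_def)

lemma finite_words [simp]: "finite (words N k)"
  using finite_lists_length_eq[of "{1..N}" k] by (simp add: words_def conj_commute)

lemma card_words: "card (words N k) = N ^ k"
  using card_lists_length_eq[of "{1..N}" k] by (simp add: words_def conj_commute)

lemma words_add: "words N (k + l) = (\<lambda>(v, w). v @ w) ` (words N k \<times> words N l)"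
proof
  show "words N (k + l) \<subseteq> (\<lambda>(v, w). v @ w) ` (words N k \<times> words N l)"
  proof
    fix u assume u: "u \<in> words N (k + l)"
    then have "(take k u, drop k u) \<in> words N k \<times> words N l"
      by (auto simp: words_def dest: in_set_takeD in_set_dropD)
    then have "(\<lambda>(v, w). v @ w) (take k u, drop k u) \<in> (\<lambda>(v, w). v @ w) ` (words N k \<times> words N l)"
      by (rule imageI)
    then show "u \<in> (\<lambda>(v, w). v @ w) ` (words N k \<times> words N l)" by simp
  qed
qed (auto simp: words_def subset_iff)

lemma words_Suc: "words N (Suc k) = (\<lambda>(i, w). i # w) ` ({1..N} \<times> words N k)"
  by (force simp: words_def length_Suc_conv image_iff)

context contracting_affine_ifs
begin

definition word_matrix :: "nat list \<Rightarrow> real^'n^'n" where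
  "word_matrix w = foldr (\<lambda>i M. A i ** M) w (mat 1)"

lemma word_matrix_Nil [simp]: "word_matrix [] = mat 1"
  and word_matrix_Cons [simp]: "word_matrix (i # w) = A i ** word_matrix w"
  by (simp_all add: word_matrix_def)

lemma word_matrix_append: "word_matrix (v @ w) = word_matrix v ** word_matrix w"
  by (induction v) (simp_all add: matrix_mul_assoc)

lemma word_map_eq:
  assumes "w \<in> words N k"
  shows "word_map S w x = word_matrix w *v x + word_map S w 0"
proof -
  have "set w \<subseteq> {1..N}" using assms by (simp add: words_def)
  then show ?thesis
  proof (induction w arbitrary: x)
    case (Cons i w)
    then have i: "i \<in> {1..N}" by simp
    have IH: "word_map S w x = word_matrix w *v x + word_map S w 0"
      by (rule Cons.IH) (use Cons.prems in simp)
    have "word_map S (i # w) y = A i *v word_map S w y + b i" for y by (simp add: S_eq[OF i])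
    then show ?case
      by (simp only:) (subst IH, simp add: matrix_vector_right_distrib matrix_vector_mul_assoc)
  qed simp
qed

lemma invertible_word_matrix:
  assumes "w \<in> words N k"
  shows "invertible (word_matrix w)"
proof -
  have "set w \<subseteq> {1..N}" using assms by (simp add: words_def)
  then show ?thesis
    by (induction w) (simp_all add: invertible_A invertible_mult invertible_det_nz[of "mat 1"])
qed

lemma norm_word_matrix_le:
  assumes "w \<in> words N k"
  shows "norm (word_matrix w *v x) \<le> c ^ k * norm x"
proof -
  have "set w \<subseteq> {1..N}" "length w = k" using assms by (simp_all add: words_def)
  then show ?thesis
  proof (induction w arbitrary: k)
    case (Cons i w)
    have "norm (word_matrix (i # w) *v x) = norm (A i *v (word_matrix w *v x))"
      by (simp add: matrix_vector_mul_assoc)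
    also have "\<dots> \<le> c * norm (word_matrix w *v x)" using Cons.prems by (intro norm_A_le) simp
    also have "\<dots> \<le> c * (c ^ length w * norm x)"
      using Cons c_pos by (intro mult_left_mono) auto
    finally show ?case using Cons.prems by auto
  qed simp
qed

lemma linear_part_word_map:
  assumes "w \<in> words N k"
  shows "linear_part (word_map S w) = word_matrix w"
proof -
  have "(\<lambda>x. word_map S w x - word_map S w 0) = (\<lambda>x. word_matrix w *v x)"
    by (rule ext) (subst word_map_eq[OF assms], simp)
  then show ?thesis by (simp add: linear_part_def)
qed

lemma singular_values_word_le:
  assumes "w \<in> words N k" "i < CARD('n)"
  shows "singular_values (word_matrix w) ! i \<le> c ^ k"
  using assms(2) by (intro singular_values_le invertible_word_matrix[OF assms(1)] norm_word_matrix_le[OF assms(1)])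

text \<open>The number \<open>s\<^sub>k\<close> is the zero of \<open>level_sum k t - 1\<close>.\<close>

definition level_sum :: "nat \<Rightarrow> real \<Rightarrow> real" where
  "level_sum k t = (\<Sum>w\<in>words N k. sv_function t (word_matrix w))"

lemma level_sum_zero: "level_sum k 0 = real N ^ k"
  by (simp add: level_sum_def card_words)

lemma words_nonempty: "words N k \<noteq> {}"
  using card_words[of N k] N_ge_1 by (metis card.empty power_eq_0_iff not_one_le_zero)

lemma level_sum_pos: "0 \<le> t \<Longrightarrow> 0 < level_sum k t"
  unfolding level_sum_def
  by (intro sum_pos words_nonempty) (auto intro: sv_function_pos invertible_word_matrix)

lemma continuous_on_level_sum: "continuous_on {0..} (level_sum k)"
  unfolding level_sum_def
  by (intro continuous_on_sum continuous_on_sv_function invertible_word_matrix)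

lemma level_sum_decay:
  assumes "0 \<le> t" "t \<le> t'"
  shows "level_sum k t' \<le> level_sum k t * (c ^ k) powr (t' - t)"
  unfolding level_sum_def sum_distrib_right
  using assms by (intro sum_mono sv_function_decay invertible_word_matrix singular_values_word_le)

lemma level_sum_strict_antimono:
  assumes "1 \<le> k" "0 \<le> t" "t < t'"
  shows "level_sum k t' < level_sum k t"
proof -
  have "c ^ k < 1" using assms(1) c_pos c_less_1 power_strict_decreasing[of 0 k c] by simp
  then have "(c ^ k) powr (t' - t) < 1 powr (t' - t)"
    using assms(3) c_pos by (intro powr_less_mono2) simp_all
  then have "level_sum k t * (c ^ k) powr (t' - t) < level_sum k t"
    using level_sum_pos[OF assms(2), of k] by simp
  then show ?thesis using level_sum_decay[of t t' k] assms by simp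
qed

lemma level_sum_add_le:
  assumes "0 \<le> t"
  shows "level_sum (k + l) t \<le> product_const TYPE('n) * (level_sum k t * level_sum l t)"
proof -
  have inj: "inj_on (\<lambda>(v, w). v @ w) (words N k \<times> words N l)"
    by (auto simp: inj_on_def words_def)
  have "level_sum (k + l) t
      = (\<Sum>(v, w)\<in>words N k \<times> words N l. sv_function t (word_matrix v ** word_matrix w))"
    unfolding level_sum_def words_add
    by (subst sum.reindex[OF inj]) (simp add: case_prod_unfold word_matrix_append)
  also have "\<dots> \<le> (\<Sum>(v, w)\<in>words N k \<times> words N l.
      product_const TYPE('n) * (sv_function t (word_matrix v) * sv_function t (word_matrix w)))"
    by (intro sum_mono) (auto intro!: sv_function_mult_le invertible_word_matrix assms)
  also have "\<dots> = product_const TYPE('n) * (level_sum k t * level_sum l t)"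
  proof -
    have "level_sum k t * level_sum l t = (\<Sum>(v, w)\<in>words N k \<times> words N l.
        sv_function t (word_matrix v) * sv_function t (word_matrix w))"
      by (simp add: level_sum_def sum_product sum.cartesian_product)
    then show ?thesis by (simp add: sum_distrib_left case_prod_unfold)
  qed
  finally show ?thesis .
qed

lemma level_sum_decay_of_root:
  assumes "0 \<le> s" "s \<le> t" "level_sum k s \<le> 1"
  shows "level_sum k t \<le> (c ^ k) powr (t - s)"
proof -
  have "level_sum k t \<le> level_sum k s * (c ^ k) powr (t - s)" using assms by (intro level_sum_decay)
  also have "\<dots> \<le> 1 * (c ^ k) powr (t - s)" using assms by (intro mult_right_mono) auto
  finally show ?thesis by simp
qed

text \<open>The exponent \<open>t\<close> with \<open>N c\<^sup>t = 1\<close>, an upper bound for every \<open>s\<^sub>k\<close>.\<close>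

definition approx_bound :: real where
  "approx_bound = ln (real N) / (- ln c)"

lemma approx_bound_nonneg: "0 \<le> approx_bound"
  unfolding approx_bound_def using N_ge_1 c_pos c_less_1
  by (intro divide_nonneg_nonneg) auto

lemma level_sum_approx_bound: "level_sum k approx_bound \<le> 1"
proof -
  have "ln c \<noteq> 0" using c_pos c_less_1 by simp
  then have "c powr approx_bound = inverse (real N)"
    using c_pos N_ge_1 by (simp add: powr_def approx_bound_def exp_minus)
  then have 1: "(c ^ k) powr approx_bound = inverse (real N) ^ k"
    using c_pos by (metis powr_power power_not_zero less_irrefl powr_powr mult.commute powr_realpow)
  have "level_sum k approx_bound \<le> level_sum k 0 * (c ^ k) powr (approx_bound - 0)"
    by (intro level_sum_decay approx_bound_nonneg) simp
  also have "\<dots> = 1" using N_ge_1 by (simp add: 1 level_sum_zero flip: power_mult_distrib)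
  finally show ?thesis .
qed

text \<open>The level sum is continuous and strictly decreasing, at least 1 at 0, and at most 1 at
  \<open>approx_bound\<close>; so \<open>s\<^sub>k\<close> is well defined.\<close>

lemma affinity_dim_approx_root:
  assumes k: "1 \<le> k"
  shows "0 \<le> affinity_dim_approx N S k \<and> level_sum k (affinity_dim_approx N S k) = 1"
proof -
  have eq: "(\<Sum>w\<in>words N k. sv_function t (linear_part (word_map S w))) = level_sum k t" for t
    unfolding level_sum_def by (intro sum.cong) (simp_all add: linear_part_word_map)
  have "1 \<le> level_sum k 0" using N_ge_1 by (simp add: level_sum_zero)
  then obtain s where s: "0 \<le> s" "level_sum k s = 1"
    using IVT2'[of "level_sum k" approx_bound 1 0] level_sum_approx_bound approx_bound_nonneg
      continuous_on_subset[OF continuous_on_level_sum] by auto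
  have "t = s" if "0 \<le> t \<and> level_sum k t = 1" for t
    using that s level_sum_strict_antimono[OF k, of t s] level_sum_strict_antimono[OF k, of s t]
    by (cases t s rule: linorder_cases) auto
  then have "\<exists>!t. 0 \<le> t \<and> level_sum k t = 1" using s by blast
  from theI'[OF this] show ?thesis by (simp add: affinity_dim_approx_def eq)
qed

lemma affinity_dim_approx_less:
  assumes "1 \<le> k" "0 \<le> t" "level_sum k t < 1"
  shows "affinity_dim_approx N S k < t"
  using affinity_dim_approx_root[OF assms(1)] level_sum_strict_antimono[OF assms(1,2), of "affinity_dim_approx N S k"] assms(3)
  by (metis less_irrefl less_trans linorder_neqE)

lemma level_power_tendsto: 
  assumes "0 < e"
  shows "(\<lambda>k. (c ^ k) powr e) \<longlonglongrightarrow> 0"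
proof -
  have "(\<lambda>k. c ^ k) \<longlonglongrightarrow> 0" using c_pos c_less_1 by (intro LIMSEQ_power_zero) auto
  then show ?thesis
    using assms c_pos tendsto_zero_powrI[of "\<lambda>k. c ^ k" sequentially "\<lambda>_. e" e] by auto
qed

text \<open>If the level sum times the constant \<open>K\<close> of submultiplicativity is some \<open>q < 1\<close> at one level \<open>k\<close>,
  then splitting a word of length \<open>mk + r\<close> into \<open>m\<close> blocks of length \<open>k\<close> and a rest bounds its level
  sum by \<open>q\<^sup>m\<close> times one of finitely many numbers.\<close>

lemma eventually_level_sum_less_1:
  assumes t: "0 \<le> t" and k: "1 \<le> k" and small: "product_const TYPE('n) * level_sum k t < 1"
  shows "\<forall>\<^sub>F j in sequentially. level_sum j t < 1"
proof -
  define q where "q = product_const TYPE('n) * level_sum k t"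
  have q: "0 \<le> q" "q < 1"
    using small level_sum_pos[OF t, of k] product_const_ge_1[where 'n='n] by (simp_all add: q_def)
  have step: "level_sum (m * k + r) t \<le> q ^ m * level_sum r t" for m r
  proof (induction m)
    case (Suc m)
    have "level_sum (Suc m * k + r) t = level_sum (k + (m * k + r)) t" by (simp add: algebra_simps)
    also have "\<dots> \<le> q * level_sum (m * k + r) t"
      using level_sum_add_le[OF t, of k "m * k + r"] by (simp add: q_def mult.assoc)
    also have "\<dots> \<le> q * (q ^ m * level_sum r t)" using Suc q by (intro mult_left_mono)
    finally show ?case by (simp add: mult.assoc)
  qed simp
  define M where "M = (\<Sum>r<k. level_sum r t)"
  have M: "level_sum r t \<le> M" if "r < k" for r
    unfolding M_def using that level_sum_pos[OF t] by (intro member_le_sum) (auto intro: less_imp_le)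
  have M0: "0 < M" using M[of 0] k level_sum_pos[OF t, of 0] by simp
  obtain m0 where m0: "q ^ m0 < 1 / M" using real_arch_pow_inv[of "1 / M" q] M0 q by auto
  have "level_sum j t < 1" if j: "m0 * k \<le> j" for j
  proof -
    have "level_sum j t \<le> q ^ (j div k) * level_sum (j mod k) t"
      using step[of "j div k" "j mod k"] by simp
    also have "\<dots> \<le> q ^ m0 * M"
    proof (intro mult_mono)
      have "m0 \<le> j div k" using j k by (metis div_le_mono div_mult_self_is_m less_eq_Suc_le One_nat_def)
      then show "q ^ (j div k) \<le> q ^ m0" using q by (intro power_decreasing) auto
      show "level_sum (j mod k) t \<le> M" using k by (intro M) simp
    qed (use q level_sum_pos[OF t] in \<open>auto intro: less_imp_le\<close>)
    also have "\<dots> < 1" using m0 M0 by (simp add: field_simps)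
    finally show ?thesis .
  qed
  then show ?thesis unfolding eventually_sequentially by blast
qed

text \<open>The limit is the infimum of the set \<open>G\<close> of exponents \<open>t\<close> for which some level sum is smaller than
  \<open>1/K\<close>.  For \<open>t\<close> in \<open>G\<close> all later level sums become smaller than 1, so eventually \<open>s\<^sub>j < t\<close>.  If \<open>t\<close> is
  not in \<open>G\<close> and \<open>s < t\<close>, then eventually \<open>s < s\<^sub>k\<close>: otherwise the level sum at \<open>t\<close> is at most
  \<open>c\<^bsup>k(t-s)\<^esup>\<close>, which falls below \<open>1/K\<close>.\<close>

lemma affinity_dim_limit: "(\<lambda>k. affinity_dim_approx N S k) \<longlonglongrightarrow> affinity_dim N S"
proof -
  let ?s = "\<lambda>k. affinity_dim_approx N S k" and ?K = "product_const TYPE('n)"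
  have K: "1 \<le> ?K" by (rule product_const_ge_1)
  define G where "G = {t. 0 \<le> t \<and> (\<exists>k\<ge>1. ?K * level_sum k t < 1)}"
  have small: "\<forall>\<^sub>F k in sequentially. ?K * (c ^ k) powr e < 1" if "0 < e" for e
  proof -
    have "(\<lambda>k. ?K * (c ^ k) powr e) \<longlonglongrightarrow> ?K * 0" using level_power_tendsto[OF that] by (intro tendsto_intros)
    then show ?thesis by (rule order_tendstoD) simp
  qed
  have below: "\<forall>\<^sub>F k in sequentially. s < ?s k" if s: "0 \<le> s" "s < t" "t \<notin> G" for s t
  proof -
    have "0 < t - s" using s by simp
    from small[OF this] eventually_ge_at_top[of 1] show ?thesis
    proof eventually_elim
      case (elim k)
      show "s < ?s k"
      proof (rule ccontr)
        assume "\<not> s < ?s k"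
        then have le: "?s k \<le> s" by simp
        note root = affinity_dim_approx_root[of k]
        have "level_sum k s \<le> 1"
          using root elim le level_sum_strict_antimono[of k "?s k" s] by (cases "?s k = s") auto
        then have "level_sum k t \<le> (c ^ k) powr (t - s)" using s by (intro level_sum_decay_of_root) auto
        then have "?K * level_sum k t \<le> ?K * (c ^ k) powr (t - s)" using K by (intro mult_left_mono) auto
        then show False using elim s by (auto simp: G_def)
      qed
    qed
  qed
  have above: "\<forall>\<^sub>F k in sequentially. ?s k < t" if tG: "t \<in> G" for t
  proof -
    obtain k where "0 \<le> t" "1 \<le> k" "?K * level_sum k t < 1" using tG by (auto simp: G_def)
    from eventually_level_sum_less_1[OF this] eventually_ge_at_top[of 1] show ?thesis
      by eventually_elim (rule affinity_dim_approx_less[OF _ \<open>0 \<le> t\<close>])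
  qed
  have "G \<noteq> {}"
  proof
    assume "G = {}"
    then have "\<forall>\<^sub>F k in sequentially. approx_bound < ?s k"
      using approx_bound_nonneg by (intro below[of _ "approx_bound + 1"]) auto
    then obtain k where "1 \<le> k" "approx_bound < ?s k"
      using eventually_happens'[OF sequentially_bot eventually_conj[OF _ eventually_ge_at_top[of 1]]] by blast
    then show False
      using affinity_dim_approx_root[of k] level_sum_strict_antimono[of k approx_bound "?s k"]
        approx_bound_nonneg level_sum_approx_bound[of k] by simp
  qed
  have bdd: "bdd_below G" by (rule bdd_belowI[of _ 0]) (simp add: G_def)
  have "?s \<longlonglongrightarrow> Inf G"
  proof (rule order_tendstoI)
    fix a assume a: "a < Inf G"
    show "\<forall>\<^sub>F k in sequentially. a < ?s k"
    proof (cases "a < 0")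
      case True
      show ?thesis using eventually_ge_at_top[of 1]
        by eventually_elim (use True affinity_dim_approx_root in force)
    next
      case False
      have "(a + Inf G) / 2 \<notin> G"
        using a cInf_lower[OF _ bdd, of "(a + Inf G) / 2"] by (auto simp: field_simps)
      then show ?thesis using False a by (intro below[of _ "(a + Inf G) / 2"]) auto
    qed
  next
    fix a assume "Inf G < a"
    then obtain t where t: "t \<in> G" "t < a" using cInf_lessD[OF \<open>G \<noteq> {}\<close>] by blast
    show "\<forall>\<^sub>F k in sequentially. ?s k < a"
      using above[OF t(1)] by eventually_elim (use t(2) in simp)
  qed
  then show ?thesis unfolding affinity_dim_def by (simp add: limI)
qed

lemma affinity_dim_nonneg: "0 \<le> affinity_dim N S"
  using affinity_dim_approx_root
  by (intro tendsto_lowerbound[OF affinity_dim_limit])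
     (auto intro!: eventually_mono[OF eventually_ge_at_top[of 1]])

lemma level_sum_tendsto_0:
  assumes "affinity_dim N S < t"
  shows "(\<lambda>k. level_sum k t) \<longlonglongrightarrow> 0"
proof -
  define t0 where "t0 = (affinity_dim N S + t) / 2"
  have t0: "affinity_dim N S < t0" "t0 < t" "0 \<le> t0"
    using assms affinity_dim_nonneg by (auto simp: t0_def)
  have "\<forall>\<^sub>F k in sequentially. affinity_dim_approx N S k < t0"
    using order_tendstoD(2)[OF affinity_dim_limit t0(1)] .
  then have "\<forall>\<^sub>F k in sequentially. norm (level_sum k t) \<le> (c ^ k) powr (t - t0)"
    using eventually_ge_at_top[of 1]
  proof eventually_elim
    case (elim k)
    have "level_sum k t0 \<le> 1"
      using affinity_dim_approx_root[of k] elim level_sum_strict_antimono[of k "affinity_dim_approx N S k" t0] by simp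
    then show ?case
      using t0 level_sum_decay_of_root[of t0 t k] level_sum_pos[of t k] by simp
  qed
  then show ?thesis using t0 by (intro Lim_null_comparison[OF _ level_power_tendsto[of "t - t0"]]) auto
qed

end

section \<open>Attractors\<close>

context contracting_affine_ifs
begin

lemma S_lipschitz: "i \<in> {1..N} \<Longrightarrow> norm (S i x - S i y) \<le> c * norm (x - y)"
  using norm_A_le[of i "x - y"] by (simp add: S_eq matrix_vector_mult_diff_distrib)

lemma continuous_on_S: "i \<in> {1..N} \<Longrightarrow> continuous_on X (S i)"
proof -
  assume i: "i \<in> {1..N}"
  have "continuous_on X (\<lambda>x. A i *v x + b i)"
    by (intro continuous_intros linear_continuous_on) (simp add: linear_conv_bounded_linear[symmetric])
  then show ?thesis by (rule continuous_on_eq) (simp add: S_eq[OF i])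
qed

text \<open>Following a point of \<open>F\<close> backwards through \<open>k\<close> maps, it lies within \<open>c\<^sup>k D\<close> of \<open>G\<close>.  With equalities in
  place of the inclusions this gives uniqueness of the attractor, and with different condensation
  sets it compares the attractors.\<close>

lemma sub_attractor_subset_super_attractor:
  assumes F: "bounded F" "F \<subseteq> (\<Union>i\<in>{1..N}. S i ` F) \<union> C"
    and G: "closed G" "G \<noteq> {}" "(\<Union>i\<in>{1..N}. S i ` G) \<union> C \<subseteq> G"
  shows "F \<subseteq> G"
proof
  fix x assume x: "x \<in> F"
  obtain g where g: "g \<in> G" using G(2) by blast
  obtain D where D: "\<And>x. x \<in> F \<Longrightarrow> dist x g \<le> D"
    using bounded_any_center[of F g] F(1) by (auto simp: dist_commute)
  have step: "\<forall>x\<in>F. \<exists>y\<in>G. dist x y \<le> c ^ k * D" for k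
  proof (induction k)
    case 0
    show ?case using D g by auto
  next
    case (Suc k)
    show ?case
    proof
      fix x assume x: "x \<in> F"
      then consider i y where "i \<in> {1..N}" "y \<in> F" "x = S i y" | "x \<in> C" using F(2) by auto
      then show "\<exists>y\<in>G. dist x y \<le> c ^ Suc k * D"
      proof cases
        case 1
        obtain z where z: "z \<in> G" "dist y z \<le> c ^ k * D" using Suc 1(2) by blast
        have "dist x (S i z) \<le> c * dist y z" using S_lipschitz[OF 1(1)] 1(3) by (simp add: dist_norm)
        also have "\<dots> \<le> c * (c ^ k * D)" using z(2) c_pos by (intro mult_left_mono) auto
        finally have "dist x (S i z) \<le> c ^ Suc k * D" by simp
        moreover have "S i z \<in> G" using G(3) 1(1) z(1) by blast
        ultimately show ?thesis by blast
      next
        case 2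
        have "0 \<le> D" using D[OF x] zero_le_dist order_trans by blast
        then have "dist x x \<le> c ^ Suc k * D" using c_pos by simp
        then show ?thesis using 2 G(3) by blast
      qed
    qed
  qed
  have lim: "(\<lambda>k. c ^ k * D) \<longlonglongrightarrow> 0"
    using c_pos c_less_1 tendsto_mult_left_zero[OF LIMSEQ_power_zero[of c], of D] by simp
  have "\<exists>y\<in>G. dist y x < e" if "0 < e" for e
  proof -
    have "\<forall>\<^sub>F k in sequentially. c ^ k * D < e" using order_tendstoD(2)[OF lim that] .
    then obtain k where "c ^ k * D < e" using eventually_happens'[OF sequentially_bot] by blast
    then show ?thesis using step[of k] x by (metis dist_commute le_less_trans)
  qed
  then show "x \<in> G" using G(1) by (metis closure_approachable closure_closed)
qed

lemma invariant_ball_exists: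
  fixes C :: "(real^'n) set"
  assumes "bounded C"
  obtains R where "C \<subseteq> cball 0 R" "\<And>i. i \<in> {1..N} \<Longrightarrow> S i ` cball 0 R \<subseteq> cball 0 R"
proof -
  obtain R0 where R0: "\<And>x. x \<in> C \<Longrightarrow> norm x \<le> R0" using assms by (auto simp: bounded_iff)
  define M where "M = (\<Sum>i\<in>{1..N}. norm (b i))"
  have M: "norm (b i) \<le> M" if "i \<in> {1..N}" for i
    unfolding M_def using that by (intro member_le_sum) auto
  define R where "R = max R0 (M / (1 - c))"
  have R: "R0 \<le> R" "M / (1 - c) \<le> R" by (simp_all add: R_def)
  have "M \<le> R * (1 - c)" using R(2) c_less_1 by (simp add: pos_divide_le_eq)
  then have MR: "c * R + M \<le> R" by (simp add: algebra_simps)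
  show thesis
  proof
    show "C \<subseteq> cball 0 R" using R0 R(1) by force
    fix i assume i: "i \<in> {1..N}"
    have "norm (S i x) \<le> R" if "norm x \<le> R" for x
    proof -
      have "norm (S i x) \<le> norm (A i *v x) + norm (b i)" by (simp add: S_eq[OF i] norm_triangle_ineq)
      also have "\<dots> \<le> c * R + M"
        using c_pos that
        by (intro add_mono M[OF i] order_trans[OF norm_A_le[OF i] mult_left_mono]) simp_all
      finally show ?thesis using MR by simp
    qed
    then show "S i ` cball 0 R \<subseteq> cball 0 R" by auto
  qed
qed

text \<open>The smallest set that contains \<open>C\<close> and is mapped into itself by the IFS.  Its closure is the
  attractor, if \<open>C\<close> is non-empty.\<close>

definition orbit :: "(real^'n) set \<Rightarrow> (real^'n) set" where
  "orbit C = (\<Union>k. \<Union>w\<in>words N k. word_map S w ` C)"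

lemma orbit_unfold: "orbit C = (\<Union>i\<in>{1..N}. S i ` orbit C) \<union> C"
proof
  show "orbit C \<subseteq> (\<Union>i\<in>{1..N}. S i ` orbit C) \<union> C"
  proof
    fix x assume "x \<in> orbit C"
    then obtain k w where w: "w \<in> words N k" "x \<in> word_map S w ` C" by (auto simp: orbit_def)
    show "x \<in> (\<Union>i\<in>{1..N}. S i ` orbit C) \<union> C"
    proof (cases k)
      case 0
      then show ?thesis using w by simp
    next
      case (Suc l)
      then obtain i v where "i \<in> {1..N}" "v \<in> words N l" "w = i # v" using w(1) by (auto simp: words_Suc)
      then show ?thesis using w(2) by (fastforce simp: orbit_def)
    qed
  qed
  show "(\<Union>i\<in>{1..N}. S i ` orbit C) \<union> C \<subseteq> orbit C"
  proof (intro Un_least UN_least image_subsetI)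
    fix i x assume i: "i \<in> {1..N}" and "x \<in> orbit C"
    then obtain k w z where w: "w \<in> words N k" "z \<in> C" "x = word_map S w z" by (auto simp: orbit_def)
    then have "i # w \<in> words N (Suc k)" "S i x = word_map S (i # w) z"
      using i by (auto simp: words_Suc)
    then show "S i x \<in> orbit C" using w(2) unfolding orbit_def by blast
  next
    have "word_map S [] ` C \<subseteq> orbit C" unfolding orbit_def using words_0 by blast
    then show "C \<subseteq> orbit C" by simp
  qed
qed

lemma bounded_orbit:
  assumes "bounded C"
  shows "bounded (orbit C)"
proof -
  obtain R where R: "C \<subseteq> cball 0 R" "\<And>i. i \<in> {1..N} \<Longrightarrow> S i ` cball 0 R \<subseteq> cball 0 R"
    using invariant_ball_exists[OF assms] by blast
  have "word_map S w ` C \<subseteq> cball 0 R" if "set w \<subseteq> {1..N}" for w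
    using that
  proof (induction w)
    case (Cons i w)
    then have "word_map S w ` C \<subseteq> cball 0 R" "i \<in> {1..N}" by auto
    then have "S i ` (word_map S w ` C) \<subseteq> cball 0 R" using R(2)[of i] by blast
    then show ?case by (simp add: image_comp)
  qed (simp add: R(1))
  then have "orbit C \<subseteq> cball 0 R" unfolding orbit_def words_def by blast
  then show ?thesis using bounded_cball bounded_subset by blast
qed

lemma attractor_exists_nonempty:
  assumes C: "compact C" "C \<noteq> {}"
  shows "\<exists>F. compact F \<and> F \<noteq> {} \<and> F = (\<Union>i\<in>{1..N}. S i ` F) \<union> C"
proof (intro exI conjI)
  let ?X = "orbit C"
  have bdd: "bounded ?X" using C by (intro bounded_orbit compact_imp_bounded)
  then have comp: "compact (closure ?X)" by (simp add: compact_closure)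
  then show "compact (closure ?X)" .
  have "C \<subseteq> ?X" using orbit_unfold[of C] by blast
  then show "closure ?X \<noteq> {}" using C(2) by auto
  have "S i ` closure ?X = closure (S i ` ?X)" if i: "i \<in> {1..N}" for i
  proof
    show "S i ` closure ?X \<subseteq> closure (S i ` ?X)"
      using continuous_on_S[OF i] by (rule image_closure_subset) (simp_all add: closure_subset)
    have "compact (S i ` closure ?X)" using comp continuous_on_S[OF i] by (rule compact_continuous_image[rotated])
    then show "closure (S i ` ?X) \<subseteq> S i ` closure ?X"
      by (intro closure_minimal image_mono closure_subset compact_imp_closed)
  qed
  then have "(\<Union>i\<in>{1..N}. S i ` closure ?X) \<union> C = (\<Union>i\<in>{1..N}. closure (S i ` ?X)) \<union> closure C"
    using C(1) by (simp add: compact_imp_closed)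
  also have "\<dots> = closure ((\<Union>i\<in>{1..N}. S i ` ?X) \<union> C)"
  proof -
    have "(\<Union>i\<in>I. closure (E i)) = closure (\<Union>i\<in>I. E i)" if "finite I"
      for I :: "nat set" and E :: "nat \<Rightarrow> (real^'n) set"
      using that by induction (simp_all add: closure_Un)
    then show ?thesis by (simp add: closure_Un)
  qed
  also have "\<dots> = closure ?X" using orbit_unfold[of C] by simp
  finally show "closure ?X = (\<Union>i\<in>{1..N}. S i ` closure ?X) \<union> C" by simp
qed

text \<open>For empty \<open>C\<close>, condense on the fixed point \<open>z\<close> of \<open>S\<^sub>1\<close>: as \<open>z\<close> lies in the image of the attractor under
  \<open>S\<^sub>1\<close> anyway, the same set satisfies the homogeneous equation.\<close>

lemma attractor_exists:
  assumes C: "compact C"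
  shows "\<exists>F. compact F \<and> F \<noteq> {} \<and> F = (\<Union>i\<in>{1..N}. S i ` F) \<union> C"
proof (cases "C = {}")
  case True
  have 1: "1 \<in> {1..N}" using N_ge_1 by simp
  then have "\<forall>x y. dist (S 1 x) (S 1 y) \<le> c * dist x y" using S_lipschitz by (simp add: dist_norm)
  then obtain z where z: "S 1 z = z" using banach_fix_type[of c "S 1"] c_pos c_less_1 by auto
  obtain F where F: "compact F" "F \<noteq> {}" "F = (\<Union>i\<in>{1..N}. S i ` F) \<union> {z}"
    using attractor_exists_nonempty[of "{z}"] by auto
  from F(3) have "z \<in> F" by blast
  then have "z \<in> S 1 ` F" using z by (intro image_eqI[of z "S 1" z]) simp_all
  then have "z \<in> (\<Union>i\<in>{1..N}. S i ` F)" using 1 by blast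
  then have "F = (\<Union>i\<in>{1..N}. S i ` F) \<union> C" using F(3) True by blast
  then show ?thesis using F by blast
next
  case False
  then show ?thesis using attractor_exists_nonempty C by blast
qed

lemma attractor_properties:
  assumes C: "compact C"
  shows "compact (attractor N S C)" "attractor N S C \<noteq> {}"
    "attractor N S C = (\<Union>i\<in>{1..N}. S i ` attractor N S C) \<union> C"
proof -
  let ?P = "\<lambda>F. compact F \<and> F \<noteq> {} \<and> F = (\<Union>i\<in>{1..N}. S i ` F) \<union> C"
  have "F \<subseteq> G" if F: "?P F" and G: "?P G" for F G
  proof (rule sub_attractor_subset_super_attractor)
    show "F \<subseteq> (\<Union>i\<in>{1..N}. S i ` F) \<union> C" using F by blast
    show "(\<Union>i\<in>{1..N}. S i ` G) \<union> C \<subseteq> G" using G by blast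
  qed (use F G in \<open>simp_all add: compact_imp_bounded compact_imp_closed\<close>)
  then have "F = G" if "?P F" "?P G" for F G using that by (meson subset_antisym)
  with attractor_exists[OF C] have "\<exists>!F. ?P F" by (rule ex_ex1I)
  from theI'[OF this] have "?P (attractor N S C)" unfolding attractor_def .
  then show "compact (attractor N S C)" "attractor N S C \<noteq> {}"
    "attractor N S C = (\<Union>i\<in>{1..N}. S i ` attractor N S C) \<union> C" by blast+
qed

lemma homogeneous_attractor_subset:
  assumes "compact C"
  shows "attractor N S {} \<subseteq> attractor N S C"
proof (rule sub_attractor_subset_super_attractor[of _ "{}"])
  show "attractor N S {} \<subseteq> (\<Union>i\<in>{1..N}. S i ` attractor N S {}) \<union> {}"
    using attractor_properties(3)[OF compact_empty] by blast
  show "(\<Union>i\<in>{1..N}. S i ` attractor N S C) \<union> {} \<subseteq> attractor N S C"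
    using attractor_properties(3)[OF assms] by blast
qed (simp_all add: attractor_properties(1,2) assms compact_imp_bounded compact_imp_closed)

text \<open>The attractor equation iterated \<open>k\<close> times.\<close>

lemma attractor_subset_level:
  assumes "compact C"
  defines "F \<equiv> attractor N S C"
  shows "F \<subseteq> (\<Union>w\<in>words N k. word_map S w ` F) \<union> (\<Union>v\<in>(\<Union>j<k. words N j). word_map S v ` C)"
proof (induction k)
  case 0
  show ?case by simp
next
  case (Suc k)
  have F: "F \<subseteq> (\<Union>i\<in>{1..N}. S i ` F) \<union> C" using attractor_properties(3)[OF assms(1)] unfolding F_def by blast
  show ?case
  proof
    fix x assume "x \<in> F"
    then consider w y where "w \<in> words N k" "y \<in> F" "x = word_map S w y"
      | v j where "j < k" "v \<in> words N j" "x \<in> word_map S v ` C" using Suc by blast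
    then show "x \<in> (\<Union>w\<in>words N (Suc k). word_map S w ` F) \<union> (\<Union>v\<in>(\<Union>j<Suc k. words N j). word_map S v ` C)"
    proof cases
      case 1
      from 1(2) F consider i z where "i \<in> {1..N}" "z \<in> F" "y = S i z" | "y \<in> C" by blast
      then show ?thesis
      proof cases
        case 1
        have "word_map S (w @ [i]) z = x"
          by (simp add: word_map_append 1 \<open>x = word_map S w y\<close>)
        moreover have "w @ [i] \<in> words N (Suc k)" using \<open>w \<in> words N k\<close> 1 by (simp add: words_def)
        ultimately show ?thesis using 1(2) by blast
      next
        case 2
        then show ?thesis using 1 by blast
      qed
    next
      case 2
      then have "v \<in> (\<Union>j<Suc k. words N j)" by (auto intro: less_SucI)
      then show ?thesis using 2(3) by blast
    qed
  qed
qed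

end

section \<open>Box dimension of the inhomogeneous attractor\<close>

lemma upper_box_dim_mono:
  fixes E F :: "(real^'n) set"
  assumes "E \<subseteq> F" "bounded F" "E \<noteq> {}"
  shows "upper_box_dim E \<le> upper_box_dim F"
  unfolding upper_box_dim_def
proof (rule Limsup_mono)
  show "\<forall>\<^sub>F d in at_right 0. ereal (ln (real (covering_number d E)) / - ln d)
          \<le> ereal (ln (real (covering_number d F)) / - ln d)"
    using eventually_at_right_real[of 0 1, simplified]
  proof eventually_elim
    case (elim d)
    then have d: "0 < d" "d < 1" by auto
    have "covering_number d E \<le> covering_number d F" using assms d by (intro covering_number_mono) auto
    moreover have "1 \<le> covering_number d E"
      using assms d bounded_subset by (intro covering_number_pos) auto
    ultimately have "ln (real (covering_number d E)) \<le> ln (real (covering_number d F))" by simp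
    then show ?case using d by (simp add: divide_right_mono_neg)
  qed
qed

lemma covering_number_le_of_upper_box_dim_less:
  fixes E :: "(real^'n) set"
  assumes E: "bounded E" "E \<noteq> {}" and t: "upper_box_dim E < ereal t"
  obtains d0 where "0 < d0" "\<And>d. \<lbrakk>0 < d; d < d0\<rbrakk> \<Longrightarrow> d powr t * real (covering_number d E) \<le> 1"
proof -
  have "\<forall>\<^sub>F d in at_right 0. ereal (ln (real (covering_number d E)) / - ln d) < ereal t"
    using t unfolding upper_box_dim_def by (rule Limsup_lessD)
  then have "\<forall>\<^sub>F d in at_right 0. d powr t * real (covering_number d E) \<le> 1"
    using eventually_at_right_real[of 0 1, simplified]
  proof eventually_elim
    case (elim d)
    then have d: "0 < d" "d < 1" by auto
    have pos: "1 \<le> real (covering_number d E)" using covering_number_pos[OF E d(1)] by simp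
    have "ln (real (covering_number d E)) / - ln d < t" using elim(1) by simp
    moreover have "0 < - ln d" using d by simp
    ultimately have "ln (real (covering_number d E)) < t * - ln d" using pos_divide_less_eq by blast
    then have "ln (d powr t * real (covering_number d E)) \<le> ln 1"
      using d pos by (simp add: ln_mult ln_powr)
    then show ?case using d pos by (subst (asm) ln_le_cancel_iff) auto
  qed
  then obtain d0 where "0 < d0" "\<forall>d>0. d < d0 \<longrightarrow> d powr t * real (covering_number d E) \<le> 1"
    unfolding eventually_at_right_field by blast
  then show thesis using that by blast
qed

text \<open>The constant \<open>B\<close> contributes \<open>ln B / (- ln d)\<close>, which vanishes in the limit.\<close>

lemma upper_box_dim_leI:
  fixes E :: "(real^'n) set"
  assumes E: "bounded E" "E \<noteq> {}"
    and B: "\<And>d. \<lbrakk>0 < d; d < 1\<rbrakk> \<Longrightarrow> d powr t * real (covering_number d E) \<le> B"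
  shows "upper_box_dim E \<le> ereal t"
proof -
  have "\<forall>\<^sub>F d in at_right 0. ereal (ln (real (covering_number d E)) / - ln d) \<le> ereal (ln B / - ln d + t)"
    using eventually_at_right_real[of 0 1, simplified]
  proof eventually_elim
    case (elim d)
    then have d: "0 < d" "d < 1" by auto
    have pos: "1 \<le> real (covering_number d E)" using covering_number_pos[OF E d(1)] by simp
    then have "0 < d powr t * real (covering_number d E)" using d by simp
    then have "ln (d powr t * real (covering_number d E)) \<le> ln B"
      using B[OF d] by (subst ln_le_cancel_iff) auto
    then have "ln (real (covering_number d E)) \<le> ln B + t * - ln d"
      using d pos by (simp add: ln_mult ln_powr)
    moreover have ld: "0 < - ln d" using d by simp
    ultimately have "ln (real (covering_number d E)) / - ln d \<le> (ln B + t * - ln d) / - ln d"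
      by (intro divide_right_mono) auto
    also have "\<dots> = ln B / - ln d + t"
      using ld nonzero_mult_div_cancel_right[of "- ln d" t] by (simp only: add_divide_distrib)
    finally show ?case by simp
  qed
  then have "upper_box_dim E \<le> Limsup (at_right 0) (\<lambda>d. ereal (ln B / - ln d + t))"
    unfolding upper_box_dim_def by (rule Limsup_mono)
  also have "\<dots> = ereal t"
  proof (rule lim_imp_Limsup)
    have "filterlim (\<lambda>d::real. - ln d) at_top (at_right 0)"
      using ln_at_0 by (simp add: filterlim_uminus_at_top)
    then have "((\<lambda>d. ln B / - ln d) \<longlongrightarrow> 0) (at_right 0)"
      by (intro tendsto_divide_0[OF tendsto_const] filterlim_at_top_imp_at_infinity)
    then have "((\<lambda>d. ln B / - ln d + t) \<longlongrightarrow> 0 + t) (at_right 0)" by (intro tendsto_add tendsto_const)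
    then show "((\<lambda>d. ereal (ln B / - ln d + t)) \<longlongrightarrow> ereal t) (at_right 0)" by simp
  qed simp
  finally show ?thesis .
qed

text \<open>The set is its own image under the identity, whose images of cubes are covered by at most a
  constant times \<open>d\<^bsup>-n\<^esup>\<close> cubes of side \<open>d\<close>.\<close>

lemma upper_box_dim_le_CARD:
  fixes E :: "(real^'n) set"
  assumes E: "bounded E" "E \<noteq> {}"
  shows "upper_box_dim E \<le> ereal (real CARD('n))"
proof (rule upper_box_dim_leI[OF E])
  let ?n = "CARD('n)" and ?I = "mat 1 :: real^'n^'n"
  let ?a = "\<lambda>i. singular_values ?I ! i"
  fix d :: real assume d: "0 < d" "d < 1"
  have inv: "invertible ?I" by (simp add: invertible_det_nz)
  have "semiaxis_count ?I d \<le> (\<Prod>i<?n. max (?a i) 1 / d)"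
    unfolding semiaxis_count_def
  proof (intro prod_mono conjI max.boundedI)
    fix i
    show "?a i / d \<le> max (?a i) 1 / d" using d by (intro divide_right_mono) auto
    show "1 \<le> max (?a i) 1 / d" using d by (simp add: pos_le_divide_eq le_max_iff_disj)
  qed (simp add: le_max_iff_disj)
  also have "\<dots> = (\<Prod>i<?n. max (?a i) 1) / d ^ ?n" by (simp add: prod_dividef)
  finally have f: "semiaxis_count ?I d \<le> (\<Prod>i<?n. max (?a i) 1) / d ^ ?n" .
  have "real (covering_number d E)
      \<le> (4 * real ?n + 2) ^ ?n * semiaxis_count ?I d * real (covering_number 1 E)"
    using covering_number_affine_image_le[OF inv E(1) zero_less_one d(1), of 0] by simp
  also have "\<dots> \<le> (4 * real ?n + 2) ^ ?n * ((\<Prod>i<?n. max (?a i) 1) / d ^ ?n) * real (covering_number 1 E)"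
    by (intro mult_right_mono mult_left_mono f) auto
  finally have "d ^ ?n * real (covering_number d E)
      \<le> d ^ ?n * ((4 * real ?n + 2) ^ ?n * ((\<Prod>i<?n. max (?a i) 1) / d ^ ?n) * real (covering_number 1 E))"
    using d by (intro mult_left_mono) auto
  also have "\<dots> = (4 * real ?n + 2) ^ ?n * (\<Prod>i<?n. max (?a i) 1) * real (covering_number 1 E)"
    using d by simp
  finally show "d powr real ?n * real (covering_number d E)
      \<le> (4 * real ?n + 2) ^ ?n * (\<Prod>i<?n. max (?a i) 1) * real (covering_number 1 E)"
    using d by (simp add: powr_realpow)
qed

context contracting_affine_ifs
begin

lemma covering_number_word_image_le:
  fixes E :: "(real^'n) set"
  assumes w: "w \<in> words N k" and E: "bounded E" and d: "0 < d" "0 < a"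
  shows "real (covering_number d (word_map S w ` E))
    \<le> (4 * real CARD('n) + 2) ^ CARD('n) * semiaxis_count (word_matrix w) a * real (covering_number (d / a) E)"
proof -
  have "word_map S w ` E = (\<lambda>x. word_matrix w *v x + word_map S w 0) ` E"
    by (intro image_cong refl word_map_eq[OF w])
  then show ?thesis
    using covering_number_affine_image_le[OF invertible_word_matrix[OF w] E, of "d / a" d "word_map S w 0"] d
    by simp
qed

text \<open>If \<open>E\<close> is covered by cubes of side \<open>d/a\<close>, the resulting estimate has the factor \<open>f(a) a\<^sup>t\<close> with the
  \<open>semiaxis_count\<close> \<open>f\<close> of the word; the choice \<open>a = \<alpha>\<^sub>m\<close> minimises this factor, and the minimum is \<open>\<phi>\<^sup>t\<close>.\<close>

lemma scaled_covering_number_word_image_le: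
  fixes E :: "(real^'n) set"
  assumes w: "w \<in> words N k" and E: "bounded E" and d: "0 < d" and t: "0 < t" "t \<le> real CARD('n)"
  defines "a \<equiv> singular_values (word_matrix w) ! (nat \<lceil>t\<rceil> - 1)"
  shows "d powr t * real (covering_number d (word_map S w ` E))
    \<le> (4 * real CARD('n) + 2) ^ CARD('n) * sv_function t (word_matrix w)
        * ((d / a) powr t * real (covering_number (d / a) E))"
proof -
  let ?K = "(4 * real CARD('n) + 2) ^ CARD('n)"
  have "nat \<lceil>t\<rceil> - 1 < CARD('n)" using t by linarith
  then have a: "0 < a" using w by (simp add: a_def singular_values_pos invertible_word_matrix)
  have \<phi>: "sv_function t (word_matrix w) = semiaxis_count (word_matrix w) a * a powr t"
    unfolding a_def by (intro sv_function_eq_semiaxis_count invertible_word_matrix[OF w] t)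
  have "d powr t * real (covering_number d (word_map S w ` E))
      \<le> d powr t * (?K * semiaxis_count (word_matrix w) a * real (covering_number (d / a) E))"
    using d a by (intro mult_left_mono covering_number_word_image_le[OF w E]) auto
  also have "d powr t * (?K * semiaxis_count (word_matrix w) a * real (covering_number (d / a) E))
      = a powr t * (d / a) powr t * (?K * semiaxis_count (word_matrix w) a * real (covering_number (d / a) E))"
    using a d by (simp flip: powr_mult)
  finally show ?thesis by (simp add: \<phi> mult_ac)
qed

text \<open>The recursive inequality for \<open>h\<close> and its solution by induction over scales.  All scales that occur for
  \<open>d < 1\<close> are at most \<open>D = 1 / min\<^sub>w a\<^sub>w\<close>; on \<open>[1, D]\<close> the function \<open>h\<close> is bounded trivially, and the
  induction extends the bound from \<open>[c\<^sup>j, D]\<close> to \<open>[c\<^bsup>j+1\<^esup>, D]\<close>.\<close>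

lemma attractor_covering_bound:
  assumes C: "compact C" "C \<noteq> {}"
    and t: "affinity_dim N S < t" "upper_box_dim C < ereal t" "t \<le> real CARD('n)"
  shows "\<exists>B. \<forall>d. 0 < d \<and> d < 1 \<longrightarrow> d powr t * real (covering_number d (attractor N S C)) \<le> B"
proof -
  define F where "F = attractor N S C"
  define K where "K = (4 * real CARD('n) + 2) ^ CARD('n)"
  define h where "h = (\<lambda>d. d powr t * real (covering_number d F))"
  have K: "0 < K" by (simp add: K_def)
  have t0: "0 < t" using t(1) affinity_dim_nonneg by simp
  have bF: "bounded F" and bC: "bounded C"
    using attractor_properties(1)[OF C(1)] C(1) by (simp_all add: F_def compact_imp_bounded)
  have "(\<lambda>k. K * level_sum k t) \<longlonglongrightarrow> K * 0"
    using level_sum_tendsto_0[OF t(1)] by (intro tendsto_intros)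
  then have "\<forall>\<^sub>F k in sequentially. K * level_sum k t < 1 / 2" by (rule order_tendstoD) simp
  from eventually_happens'[OF sequentially_bot eventually_conj[OF this eventually_ge_at_top[of 1]]]
  obtain k where k: "K * level_sum k t < 1 / 2" "1 \<le> k" by blast

  define a where "a = (\<lambda>w. singular_values (word_matrix w) ! (nat \<lceil>t\<rceil> - 1))"
  have idx: "nat \<lceil>t\<rceil> - 1 < CARD('n)" using t0 t(3) by linarith
  have a_pos: "0 < a w" if "w \<in> words N k" for w
    unfolding a_def by (intro singular_values_pos invertible_word_matrix[OF that] idx)
  have "c ^ k \<le> c" using k(2) c_pos c_less_1 power_decreasing[of 1 k c] by simp
  then have a_le: "a w \<le> c" if "w \<in> words N k" for w
    using singular_values_word_le[OF that idx] by (simp add: a_def)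
  define D where "D = 1 / Min (a ` words N k)"
  have min_pos: "0 < Min (a ` words N k)"
    using a_pos words_nonempty[of k] by simp
  have a_ge: "1 / a w \<le> D" if "w \<in> words N k" for w
    unfolding D_def using that min_pos by (intro divide_left_mono mult_pos_pos a_pos) auto

  obtain d0 where d0: "0 < d0" "\<And>d. \<lbrakk>0 < d; d < d0\<rbrakk> \<Longrightarrow> d powr t * real (covering_number d C) \<le> 1"
    using covering_number_le_of_upper_box_dim_less[OF bC C(2) t(2)] by blast
  define H where "H = max 1 (real (covering_number d0 C))"
  have H: "d powr t * real (covering_number d C) \<le> H" if d: "0 < d" "d < 1" for d
  proof (cases "d < d0")
    case True
    then show ?thesis using d0(2)[OF d(1)] by (simp add: H_def)
  next
    case False
    have "d powr t \<le> 1" using d t0 by (intro powr_le1) auto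
    moreover have "covering_number d C \<le> covering_number d0 C"
      using False by (intro covering_number_antimono bC d0(1)) auto
    ultimately have "d powr t * real (covering_number d C) \<le> 1 * real (covering_number d0 C)"
      by (intro mult_mono) auto
    then show ?thesis by (simp add: H_def)
  qed
  define V where "V = (\<Union>j<k. words N j)"
  have finV: "finite V" by (simp add: V_def)
  define M where "M = (\<Sum>v\<in>V. K * semiaxis_count (word_matrix v) 1)"
  have M: "0 \<le> M" unfolding M_def using K
    by (intro sum_nonneg mult_nonneg_nonneg less_imp_le[OF semiaxis_count_pos]) auto

  have bw: "bounded (word_map S w ` E)" if "w \<in> words N j" "bounded E" for w j E
  proof -
    have "bounded ((\<lambda>y. y + word_map S w 0) ` ((\<lambda>x. word_matrix w *v x) ` E))"
      using that(2)
      by (intro bounded_translation_minus[of _ "- word_map S w 0", simplified] bounded_linear_image)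
         (simp_all add: linear_conv_bounded_linear[symmetric])
    moreover have "(\<lambda>y. y + word_map S w 0) ` ((\<lambda>x. word_matrix w *v x) ` E) = word_map S w ` E"
      unfolding image_image by (intro image_cong refl word_map_eq[OF that(1), symmetric])
    ultimately show ?thesis by simp
  qed

  have rec: "h d \<le> (\<Sum>w\<in>words N k. K * sv_function t (word_matrix w) * h (d / a w)) + M * H"
    if d: "0 < d" "d < 1" for d
  proof -
    let ?X = "\<Union>w\<in>words N k. word_map S w ` F" and ?Y = "\<Union>v\<in>V. word_map S v ` C"
    have bX: "bounded ?X" by (intro bounded_UN finite_words ballI bw bF)
    have bV: "bounded (word_map S v ` C)" if "v \<in> V" for v
      using that bC by (auto simp: V_def intro: bw)
    have bY: "bounded ?Y" using finV bV by (intro bounded_UN ballI)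
    have "F \<subseteq> ?X \<union> ?Y" unfolding F_def V_def by (rule attractor_subset_level[OF C(1)])
    then have "covering_number d F \<le> covering_number d (?X \<union> ?Y)"
      using bX bY d by (intro covering_number_mono) auto
    also have "\<dots> \<le> covering_number d ?X + covering_number d ?Y"
      by (intro covering_number_Un_le bX bY d)
    also have "\<dots> \<le> (\<Sum>w\<in>words N k. covering_number d (word_map S w ` F))
        + (\<Sum>v\<in>V. covering_number d (word_map S v ` C))"
      by (intro add_mono covering_number_Union_le finite_words bw bF bV d finV)
    finally have "real (covering_number d F) \<le> (\<Sum>w\<in>words N k. real (covering_number d (word_map S w ` F)))
        + (\<Sum>v\<in>V. real (covering_number d (word_map S v ` C)))"
      by (simp flip: of_nat_sum of_nat_add)
    then have "h d \<le> d powr t * ((\<Sum>w\<in>words N k. real (covering_number d (word_map S w ` F)))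
        + (\<Sum>v\<in>V. real (covering_number d (word_map S v ` C))))"
      unfolding h_def by (intro mult_left_mono) auto
    also have "\<dots> = (\<Sum>w\<in>words N k. d powr t * real (covering_number d (word_map S w ` F)))
        + (\<Sum>v\<in>V. d powr t * real (covering_number d (word_map S v ` C)))"
      by (simp add: sum_distrib_left distrib_left)
    also have "\<dots> \<le> (\<Sum>w\<in>words N k. K * sv_function t (word_matrix w) * h (d / a w)) + M * H"
    proof (rule add_mono)
      show "(\<Sum>w\<in>words N k. d powr t * real (covering_number d (word_map S w ` F)))
          \<le> (\<Sum>w\<in>words N k. K * sv_function t (word_matrix w) * h (d / a w))"
        unfolding K_def h_def a_def
        by (intro sum_mono scaled_covering_number_word_image_le bF d t0 t(3))
      have "d powr t * real (covering_number d (word_map S v ` C)) \<le> K * semiaxis_count (word_matrix v) 1 * H"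
        if v: "v \<in> V" for v
      proof -
        obtain j where j: "v \<in> words N j" using v by (auto simp: V_def)
        have "d powr t * real (covering_number d (word_map S v ` C))
            \<le> d powr t * (K * semiaxis_count (word_matrix v) 1 * real (covering_number (d / 1) C))"
          unfolding K_def using d by (intro mult_left_mono covering_number_word_image_le[OF j bC]) auto
        also have "\<dots> = K * semiaxis_count (word_matrix v) 1 * (d powr t * real (covering_number d C))" by simp
        also have "\<dots> \<le> K * semiaxis_count (word_matrix v) 1 * H"
          using K by (intro mult_left_mono H d mult_nonneg_nonneg less_imp_le[OF semiaxis_count_pos]) auto
        finally show ?thesis .
      qed
      then show "(\<Sum>v\<in>V. d powr t * real (covering_number d (word_map S v ` C))) \<le> M * H"
        unfolding M_def sum_distrib_right by (rule sum_mono)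
    qed
    finally show ?thesis .
  qed

  \<comment> \<open>The factor 2 makes \<open>B/2 + M H \<le> B\<close>, so the recursion reproduces the bound.\<close>
  define B where "B = max (D powr t * real (covering_number 1 F)) (2 * M * H)"
  have B0: "0 \<le> B" by (simp add: B_def le_max_iff_disj)
  have bound: "\<forall>d. c ^ j \<le> d \<and> d \<le> D \<longrightarrow> h d \<le> B" for j
  proof (induction j)
    case 0
    show ?case
    proof (intro allI impI)
      fix d assume d: "c ^ 0 \<le> d \<and> d \<le> D"
      then have "d powr t \<le> D powr t" using t0 by (intro powr_mono2) auto
      moreover have "covering_number d F \<le> covering_number 1 F"
        using d by (intro covering_number_antimono bF) auto
      ultimately have "h d \<le> D powr t * real (covering_number 1 F)"
        unfolding h_def by (intro mult_mono) auto
      then show "h d \<le> B" by (simp add: B_def)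
    qed
  next
    case (Suc j)
    show ?case
    proof (intro allI impI)
      fix d assume d: "c ^ Suc j \<le> d \<and> d \<le> D"
      have d_pos: "0 < d" using d c_pos zero_less_power[of c "Suc j"] by linarith
      show "h d \<le> B"
      proof (cases "d < 1")
        case False
        then have "c ^ j \<le> d" using c_pos c_less_1 power_le_one[of c j] by linarith
        then show ?thesis using Suc d by blast
      next
        case True
        have step: "h (d / a w) \<le> B" if w: "w \<in> words N k" for w
        proof -
          have "c ^ j * a w \<le> c ^ j * c" using a_le[OF w] c_pos by (intro mult_left_mono) auto
          also have "\<dots> \<le> d" using d by (simp add: mult.commute)
          finally have "c ^ j \<le> d / a w" using a_pos[OF w] by (simp add: pos_le_divide_eq)
          moreover have "d / a w \<le> 1 / a w" using True a_pos[OF w] by (intro divide_right_mono) auto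
          then have "d / a w \<le> D" using a_ge[OF w] by linarith
          ultimately show ?thesis using Suc by blast
        qed
        have "h d \<le> (\<Sum>w\<in>words N k. K * sv_function t (word_matrix w) * h (d / a w)) + M * H"
          using rec[OF d_pos True] .
        also have "\<dots> \<le> (\<Sum>w\<in>words N k. K * sv_function t (word_matrix w) * B) + M * H"
          using K t0
          by (intro add_right_mono sum_mono mult_left_mono step mult_nonneg_nonneg
              less_imp_le[OF sv_function_pos] invertible_word_matrix) auto
        also have "\<dots> = K * level_sum k t * B + M * H"
          by (simp add: level_sum_def sum_distrib_left sum_distrib_right)
        also have "\<dots> \<le> 1 / 2 * B + 1 / 2 * B"
          using k(1) B0 by (intro add_mono mult_right_mono) (auto simp: B_def)
        finally show ?thesis by simp
      qed
    qed
  qed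
  have "h d \<le> B" if d: "0 < d" "d < 1" for d
  proof -
    obtain j where "c ^ j < d" using real_arch_pow_inv[OF d(1) c_less_1] by blast
    moreover have "1 \<le> D"
    proof -
      obtain w where w: "w \<in> words N k" using words_nonempty by blast
      have "1 \<le> 1 / a w" using a_pos[OF w] a_le[OF w] c_less_1 by simp
      then show ?thesis using a_ge[OF w] by linarith
    qed
    ultimately show ?thesis using bound[of j] d by auto
  qed
  then show ?thesis unfolding h_def F_def by blast
qed

text \<open>Every \<open>z\<close> above the maximum is an upper bound: either \<open>z \<ge> n\<close>, or \<open>z\<close> is a real number to which the
  covering bound applies.\<close>

lemma upper_box_dim_attractor_le:
  assumes C: "compact C" "C \<noteq> {}"
  shows "upper_box_dim (attractor N S C) \<le> max (ereal (affinity_dim N S)) (upper_box_dim C)"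
proof (rule dense_ge)
  fix z assume z: "max (ereal (affinity_dim N S)) (upper_box_dim C) < z"
  have F: "bounded (attractor N S C)" "attractor N S C \<noteq> {}"
    using attractor_properties[OF C(1)] by (auto intro: compact_imp_bounded)
  show "upper_box_dim (attractor N S C) \<le> z"
  proof (cases "ereal (real CARD('n)) \<le> z")
    case True
    then show ?thesis using upper_box_dim_le_CARD[OF F] by (rule order_trans[rotated])
  next
    case False
    then obtain t where t: "z = ereal t" using z by (cases z) auto
    have "affinity_dim N S < t" "upper_box_dim C < ereal t" "t \<le> real CARD('n)"
      using z False by (auto simp: t)
    from attractor_covering_bound[OF C this] obtain B where
      "\<And>d. \<lbrakk>0 < d; d < 1\<rbrakk> \<Longrightarrow> d powr t * real (covering_number d (attractor N S C)) \<le> B" by blast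
    then show ?thesis unfolding t by (intro upper_box_dim_leI[OF F])
  qed
qed

lemma upper_box_dim_attractor_ge:
  assumes C: "compact C" "C \<noteq> {}"
  shows "max (upper_box_dim (attractor N S {})) (upper_box_dim C) \<le> upper_box_dim (attractor N S C)"
proof (rule max.boundedI)
  have bdd: "bounded (attractor N S C)" using attractor_properties(1)[OF C(1)] by (rule compact_imp_bounded)
  show "upper_box_dim (attractor N S {}) \<le> upper_box_dim (attractor N S C)"
    by (intro upper_box_dim_mono homogeneous_attractor_subset C bdd attractor_properties(2)) simp
  have "C \<subseteq> attractor N S C" using attractor_properties(3)[OF C(1)] by blast
  then show "upper_box_dim C \<le> upper_box_dim (attractor N S C)"
    by (intro upper_box_dim_mono bdd C(2))
qed

end

theorem theorem2p1:
  fixes N :: nat and S :: "nat \<Rightarrow> real^'n \<Rightarrow> real^'n" and C :: "(real^'n) set"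
  assumes "affine_ifs N S" and "compact C" and "C \<noteq> {}"
  shows "max (upper_box_dim (attractor N S {})) (upper_box_dim C)
           \<le> upper_box_dim (attractor N S C) \<and>
         upper_box_dim (attractor N S C)
           \<le> max (ereal (affinity_dim N S)) (upper_box_dim C)"
proof -
  obtain A b c where "contracting_affine_ifs N S A b c" using affine_ifs_contracting[OF assms(1)] .
  then interpret contracting_affine_ifs N S A b c .
  show ?thesis using upper_box_dim_attractor_ge upper_box_dim_attractor_le assms(2,3) by blast
qed

end
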